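(* As $n\to\infty$, \[ N_{\rm bi}(n, 2) \sim \frac{5}{48}\,n^{n+1}. \]
   Context: For integers $r,s\ge 0$ and $k$, $N_{\rm bi}(r,s,k)$ is the number of connected bipartite simple graphs with labeled bipartition $V_1\sqcup V_2$, $|V_1|=r$, $|V_2|=s$, having exactly $r+s+k-1$ edges; equivalently, the number of connected spanning subgraphs of the complete bipartite graph $K_{r,s}$ with $r+s+k-1$ edges (so the Betti number is $k$). Conventions: if $rs=0$, then $N_{\rm bi}(r,s,k)=1$ if $k=0$ and $(r,s)\in\{(1,0),(0,1)\}$, and $0$ otherwise. Define \[ N_{\rm bi}(n,k) := \sum_{r+s=n}\binom{n}{r}N_{\rm bi}(r,s,k), \] which is the coefficient of $x^n/n!$ in $F_k(x,x)$, where $F_k(x,y)=\sum_{r,s\ge0}\frac{N_{\rm bi}(r,s,k)}{r!s!}x^ry^s$. Here $a_n\sim b_n$ means $a_n/b_n\to1$. *)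

theory Defs
  imports Complex_Main "HOL-Library.Landau_Symbols"
begin

text \<open>
  The two colour classes are the two summands of \<open>nat + nat\<close>: the vertices of \<open>V\<^sub>1\<close> are
  \<open>Inl i\<close> with \<open>i < r\<close>, those of \<open>V\<^sub>2\<close> are \<open>Inr j\<close> with \<open>j < s\<close>. An edge of a simple graph is the
  two-element set of its endpoints.
\<close>

definition bip_verts :: "nat \<Rightarrow> nat \<Rightarrow> (nat + nat) set" where
  "bip_verts r s = Inl ` {..<r} \<union> Inr ` {..<s}"

definition complete_bip_edges :: "nat \<Rightarrow> nat \<Rightarrow> (nat + nat) set set" where
  "complete_bip_edges r s = {{Inl i, Inr j} | i j. i < r \<and> j < s}"

text \<open>The graph without vertices does not count as connected.\<close>

definition graph_connected :: "'v set \<Rightarrow> 'v set set \<Rightarrow> bool" where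
  "graph_connected V E \<longleftrightarrow> V \<noteq> {} \<and> (\<forall>u\<in>V. \<forall>v\<in>V. (u, v) \<in> {(x, y). {x, y} \<in> E}\<^sup>*)"

definition N_bi :: "nat \<Rightarrow> nat \<Rightarrow> int \<Rightarrow> nat" where
  "N_bi r s k = card {E. E \<subseteq> complete_bip_edges r s \<and> graph_connected (bip_verts r s) E \<and>
                        int (card E) = int r + int s + k - 1}"

definition N_bi_total :: "nat \<Rightarrow> int \<Rightarrow> nat" where
  "N_bi_total n k = (\<Sum>r\<le>n. (n choose r) * N_bi r (n - r) k)"

text \<open>
  The definition of \<open>N_bi\<close> yields the usual conventions for the degenerate case of an
  empty colour class.
\<close>

lemma N_bi_degenerate:
  assumes "r * s = 0"
  shows "N_bi r s k = (if k = 0 \<and> (r, s) \<in> {(1, 0), (0, 1)} then 1 else 0)"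
proof -
  have edges: "complete_bip_edges r s = {}"
    using assms by (auto simp: complete_bip_edges_def)
  have conn: "graph_connected (bip_verts r s) {} \<longleftrightarrow> (r, s) \<in> {(1, 0), (0, 1)}"
  proof
    assume "(r, s) \<in> {(1, 0), (0, 1)}"
    then show "graph_connected (bip_verts r s) {}"
      by (auto simp: graph_connected_def bip_verts_def)
  next
    assume g: "graph_connected (bip_verts r s) {}"
    then have eq: "u = v" if "u \<in> bip_verts r s" "v \<in> bip_verts r s" for u v
      using that by (auto simp: graph_connected_def)
    have ne: "r \<noteq> 0 \<or> s \<noteq> 0"
      using g by (auto simp: graph_connected_def bip_verts_def)
    have "r \<le> 1"
      using eq[of "Inl 0" "Inl 1"] by (force simp: bip_verts_def)
    moreover have "s \<le> 1"
      using eq[of "Inr 0" "Inr 1"] by (force simp: bip_verts_def)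
    ultimately show "(r, s) \<in> {(1, 0), (0, 1)}"
      using ne assms by auto
  qed
  have "{E. E \<subseteq> complete_bip_edges r s \<and> graph_connected (bip_verts r s) E \<and>
            int (card E) = int r + int s + k - 1} =
        (if k = 0 \<and> (r, s) \<in> {(1, 0), (0, 1)} then {{}} else {})"
    using conn by (auto simp: edges)
  then show ?thesis
    by (simp add: N_bi_def)
qed

end

(*
  Deleting an edge of a connected bipartite graph leaves either a connected graph or two connected
  graphs, one containing the V_1-end and the other the V_2-end of the edge. For the exponential
  generating functions F_k(x, y) this gives, with D = x d/dx and D' = y d/dy,
    (D + D' + k - 1) F_k = (D D' - D - D' - (k - 2)) F_(k-1) + sum_(j <= k) D F_j * D' F_(k-j)
  (the middle term being absent for k = 0). Put A = D F_0 and B = D' F_0. The vector field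
  L = (1 - B) D + (1 - A) D' satisfies L A = A and L B = B, and for k > 0 the equation reads
  (L + k - 1) F_k = a known expression. Since L has only trivial kernels in high degree, this forces
  D A = A/(1-AB), D B = AB/(1-AB), 2 D F_1 = (AB)^2 (1 + A)/(1-AB)^2, and makes (L + 1) F_2 a
  rational function of A and B.

  On the diagonal x = y one has A = B = T, the tree series with (1 - T) x T' = T, and L becomes
  (1 - T) x d/dx. So F_2(x, x) = g(T) where the coefficients of g are those of
  (5/48) (1 - t)^(-3) up to O(m). Writing K = 1/(1 - T), the relation x K' = K^3 - K^2 together
  with n! [x^n] K = n^n shows that n! [x^n] K^3 is n^(n+1) + n! [x^n] K^2, and K^2 is negligible
  because m + 1 <= (m + 1)(m + 2)/(4 r) + r for r = sqrt n.
*)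
theory Submission
  imports Defs "HOL-Computational_Algebra.Formal_Power_Series" "HOL-Computational_Algebra.Polynomial"
begin

section \<open>Connectedness and deletion of an edge\<close>

text \<open>The obstacle is that differentiating the tree equation gives only two linear relations
  among the three second derivatives of F_0, so D A = A/(1-AB) does not follow by elimination. It is
  obtained like the formula for D F_1: a closed form is guessed, and the difference between the two
  sides is shown to solve a homogeneous system for L, which leaves only zero. The constant comes
  from the pole of the rational function at t = 1, which is (5/16) (1-t)^(-4) to leading order.
  Since (1-T) x d/dx multiplies T^m by m, inverting L + 1 divides the coefficient of t^m by m + 1
  and turns (5/16) m^3/6 into (5/48) m^2/2. The pole at t = -1 has order at most 3, so it is
  absorbed by the error term. No complex analysis enters: all powers of T have nonnegative
  coefficients, so a coefficientwise bound between series in t survives the substitution t =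
  T.\<close>

definition adj :: "'v set set \<Rightarrow> ('v \<times> 'v) set" where
  "adj E = {(x, y). {x, y} \<in> E}"

lemma graph_connected_adj:
  "graph_connected V E \<longleftrightarrow> V \<noteq> {} \<and> (\<forall>u\<in>V. \<forall>v\<in>V. (u, v) \<in> (adj E)\<^sup>*)"
  by (simp add: graph_connected_def adj_def)

lemma adj_rtrancl_sym: "(x, y) \<in> (adj E)\<^sup>* \<Longrightarrow> (y, x) \<in> (adj E)\<^sup>*"
proof -
  have "sym (adj E)" by (auto simp: sym_def adj_def insert_commute)
  then show "(x, y) \<in> (adj E)\<^sup>* \<Longrightarrow> (y, x) \<in> (adj E)\<^sup>*"
    using sym_rtrancl by (metis symD)
qed

lemma adj_rtrancl_mono: "(x, y) \<in> (adj E)\<^sup>* \<Longrightarrow> E \<subseteq> E' \<Longrightarrow> (x, y) \<in> (adj E')\<^sup>*"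
proof -
  assume "(x, y) \<in> (adj E)\<^sup>*" "E \<subseteq> E'"
  moreover have "adj E \<subseteq> adj E'" using \<open>E \<subseteq> E'\<close> by (auto simp: adj_def)
  ultimately show ?thesis using rtrancl_mono by blast
qed

lemma graph_connectedI:
  assumes "u \<in> V" "\<And>x. x \<in> V \<Longrightarrow> (u, x) \<in> (adj E)\<^sup>*"
  shows "graph_connected V E"
  unfolding graph_connected_adj
proof (intro conjI ballI)
  show "V \<noteq> {}" using assms by auto
  fix x y assume "x \<in> V" "y \<in> V"
  then show "(x, y) \<in> (adj E)\<^sup>*"
    using assms(2) adj_rtrancl_sym rtrancl_trans by metis
qed

text \<open>After its last passage through the deleted edge a walk starts afresh at \<open>u\<close>
  or at \<open>v\<close> and avoids that edge from then on.\<close>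

lemma adj_rtrancl_delete_edge:
  assumes "(u, x) \<in> (adj E)\<^sup>*"
  shows "(u, x) \<in> (adj (E - {{u, v}}))\<^sup>* \<or> (v, x) \<in> (adj (E - {{u, v}}))\<^sup>*"
  using assms
proof (induction rule: rtrancl_induct)
  case base
  then show ?case by simp
next
  case (step y z)
  show ?case
  proof (cases "{y, z} = {u, v}")
    case True
    then have "z = u \<or> z = v" by (auto simp: doubleton_eq_iff)
    then show ?thesis by auto
  next
    case False
    then have "(y, z) \<in> adj (E - {{u, v}})" using step(2) by (auto simp: adj_def)
    then show ?thesis using step(3) by (meson rtrancl.rtrancl_into_rtrancl)
  qed
qed

text \<open>A set that no edge leaves traps every walk that starts in it. This serves both to bound
  a component and to see that it is connected by its own edges.\<close>

lemma adj_rtrancl_restrict: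
  assumes "(c, x) \<in> (adj E)\<^sup>*" "c \<in> C" "\<And>y z. y \<in> C \<Longrightarrow> {y, z} \<in> E \<Longrightarrow> z \<in> C"
  shows "(c, x) \<in> (adj {f \<in> E. f \<subseteq> C})\<^sup>* \<and> x \<in> C"
  using assms(1)
proof (induction rule: rtrancl_induct)
  case base
  then show ?case using assms by simp
next
  case (step y z)
  then have "{y, z} \<in> E" by (auto simp: adj_def)
  moreover have "z \<in> C" using step calculation assms(3) by blast
  ultimately have "(y, z) \<in> adj {f \<in> E. f \<subseteq> C}" using step by (auto simp: adj_def)
  then show ?case using step \<open>z \<in> C\<close> by (meson rtrancl.rtrancl_into_rtrancl)
qed

definition edges_on :: "'v set \<Rightarrow> 'v set set \<Rightarrow> bool" where
  "edges_on V E \<longleftrightarrow> (\<forall>f\<in>E. \<exists>x y. f = {x, y} \<and> x \<in> V \<and> y \<in> V)"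

lemma edges_on_subset: "edges_on V E \<Longrightarrow> f \<in> E \<Longrightarrow> f \<subseteq> V \<and> f \<noteq> {}"
  by (fastforce simp: edges_on_def)

lemma edges_on_restrict:
  assumes "edges_on V E" "E' \<subseteq> E" "\<And>f. f \<in> E' \<Longrightarrow> f \<subseteq> W"
  shows "edges_on W E'"
  unfolding edges_on_def
proof
  fix f assume f: "f \<in> E'"
  then obtain x y where "f = {x, y}" using assms(1,2) unfolding edges_on_def by blast
  then show "\<exists>x y. f = {x, y} \<and> x \<in> W \<and> y \<in> W" using assms(3)[OF f] by blast
qed

text \<open>\<open>C\<close> is the component of \<open>u\<close> after the deletion. By
  \<open>adj_rtrancl_delete_edge\<close> all other vertices are reached from \<open>v\<close>, and
  \<open>v\<close> itself lies outside \<open>C\<close>, since otherwise the graph would still be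
  connected. No remaining edge crosses between the two sides.\<close>

lemma graph_connected_bridge_split:
  assumes E: "edges_on V E" and con: "graph_connected V E" and uv: "{u, v} \<in> E"
    and ncon: "\<not> graph_connected V (E - {{u, v}})"
  defines "C \<equiv> {x. (u, x) \<in> (adj (E - {{u, v}}))\<^sup>*}"
  shows "u \<in> C" "C \<subseteq> V" "v \<in> V - C"
    "graph_connected C {f \<in> E - {{u, v}}. f \<subseteq> C}"
    "graph_connected (V - C) {f \<in> E - {{u, v}}. f \<subseteq> V - C}"
    "E - {{u, v}} = {f \<in> E - {{u, v}}. f \<subseteq> C} \<union> {f \<in> E - {{u, v}}. f \<subseteq> V - C}"
proof -
  let ?E' = "E - {{u, v}}"
  have E': "edges_on V ?E'" using E by (auto simp: edges_on_def)
  have uvV: "u \<in> V" "v \<in> V" using edges_on_subset[OF E uv] by auto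
  show uC: "u \<in> C" by (simp add: C_def)
  have V_closed: "y \<in> V" if "{x, y} \<in> ?E'" for x y
    using edges_on_subset[OF E' that] by auto
  show CV: "C \<subseteq> V"
    using adj_rtrancl_restrict[of u _ ?E' V] V_closed uvV unfolding C_def by blast
  have C_closed: "z \<in> C" if "y \<in> C" "{y, z} \<in> ?E'" for y z
  proof -
    have "(y, z) \<in> adj ?E'" using that(2) by (simp add: adj_def)
    then show ?thesis using that(1) unfolding C_def by (auto intro: rtrancl.rtrancl_into_rtrancl)
  qed
  have reach: "x \<in> C \<or> (v, x) \<in> (adj ?E')\<^sup>*" if "x \<in> V" for x
    using adj_rtrancl_delete_edge[of u x E v] con that uvV
    unfolding C_def graph_connected_adj by blast
  have vC: "v \<notin> C"
  proof
    assume v: "v \<in> C"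
    have "graph_connected V ?E'"
    proof (rule graph_connectedI[OF uvV(1)])
      fix x assume "x \<in> V"
      then show "(u, x) \<in> (adj ?E')\<^sup>*"
        using reach[of x] v unfolding C_def by (auto intro: rtrancl_trans)
    qed
    then show False using ncon by simp
  qed
  show "v \<in> V - C" using vC uvV by simp
  show "graph_connected C {f \<in> ?E'. f \<subseteq> C}"
  proof (rule graph_connectedI[OF uC])
    fix x assume "x \<in> C"
    then show "(u, x) \<in> (adj {f \<in> ?E'. f \<subseteq> C})\<^sup>*"
      using adj_rtrancl_restrict[of u x ?E' C] C_closed uC unfolding C_def by blast
  qed
  have D_closed: "z \<in> V - C" if "y \<in> V - C" "{y, z} \<in> ?E'" for y z
    using that C_closed[of z y] V_closed by (auto simp: insert_commute)
  show "graph_connected (V - C) {f \<in> ?E'. f \<subseteq> V - C}"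
  proof (rule graph_connectedI)
    show "v \<in> V - C" using vC uvV by simp
    fix x assume "x \<in> V - C"
    then have "(v, x) \<in> (adj ?E')\<^sup>*" using reach by blast
    then show "(v, x) \<in> (adj {f \<in> ?E'. f \<subseteq> V - C})\<^sup>*"
      using adj_rtrancl_restrict[of v x ?E' "V - C"] D_closed vC uvV by blast
  qed
  show "?E' = {f \<in> ?E'. f \<subseteq> C} \<union> {f \<in> ?E'. f \<subseteq> V - C}"
  proof (rule set_eqI)
    fix f
    have "f \<subseteq> C \<or> f \<subseteq> V - C" if f: "f \<in> ?E'"
    proof -
      obtain x y where xy: "f = {x, y}" "x \<in> V" "y \<in> V"
        using E' f unfolding edges_on_def by blast
      show ?thesis
      proof (cases "x \<in> C")
        case True
        then have "y \<in> C" using C_closed f xy(1) by blast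
        then show ?thesis using True xy(1) by simp
      next
        case False
        then have "x \<in> V - C" using xy by simp
        then have "y \<in> V - C" using D_closed f xy(1) by blast
        then show ?thesis using \<open>x \<in> V - C\<close> xy(1) by simp
      qed
    qed
    then show "f \<in> ?E' \<longleftrightarrow> f \<in> {f \<in> ?E'. f \<subseteq> C} \<union> {f \<in> ?E'. f \<subseteq> V - C}"
      unfolding Un_iff mem_Collect_eq by metis
  qed
qed

lemma graph_connected_mono:
  "graph_connected V E \<Longrightarrow> E \<subseteq> E' \<Longrightarrow> graph_connected V E'"
  unfolding graph_connected_adj by (meson adj_rtrancl_mono)

lemma graph_connected_join:
  assumes "graph_connected V\<^sub>1 E\<^sub>1" "graph_connected V\<^sub>2 E\<^sub>2" "u \<in> V\<^sub>1" "v \<in> V\<^sub>2"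
  shows "graph_connected (V\<^sub>1 \<union> V\<^sub>2) (insert {u, v} (E\<^sub>1 \<union> E\<^sub>2))"
proof (rule graph_connectedI[of u])
  let ?E = "insert {u, v} (E\<^sub>1 \<union> E\<^sub>2)"
  show "u \<in> V\<^sub>1 \<union> V\<^sub>2" using assms by simp
  fix x assume "x \<in> V\<^sub>1 \<union> V\<^sub>2"
  then show "(u, x) \<in> (adj ?E)\<^sup>*"
  proof
    assume "x \<in> V\<^sub>1"
    then have "(u, x) \<in> (adj E\<^sub>1)\<^sup>*" using assms by (auto simp: graph_connected_adj)
    then show ?thesis by (rule adj_rtrancl_mono) auto
  next
    assume "x \<in> V\<^sub>2"
    then have "(v, x) \<in> (adj E\<^sub>2)\<^sup>*" using assms by (auto simp: graph_connected_adj)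
    then have "(v, x) \<in> (adj ?E)\<^sup>*" by (rule adj_rtrancl_mono) auto
    moreover have "(u, v) \<in> adj ?E" by (simp add: adj_def)
    ultimately show ?thesis by (rule converse_rtrancl_into_rtrancl[rotated])
  qed
qed

text \<open>This recovers one side of a bridge from the union of both edge sets, which is the key to
  the injectivity of gluing.\<close>

lemma reachable_disjoint_union:
  assumes "edges_on V\<^sub>1 E\<^sub>1" "edges_on V\<^sub>2 E\<^sub>2" "V\<^sub>1 \<inter> V\<^sub>2 = {}" "graph_connected V\<^sub>1 E\<^sub>1" "u \<in> V\<^sub>1"
  shows "{x. (u, x) \<in> (adj (E\<^sub>1 \<union> E\<^sub>2))\<^sup>*} = V\<^sub>1"
proof (rule set_eqI)
  fix x
  have "z \<in> V\<^sub>1" if "y \<in> V\<^sub>1" "{y, z} \<in> E\<^sub>1 \<union> E\<^sub>2" for y z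
    using that edges_on_subset[OF assms(1)] edges_on_subset[OF assms(2)] assms(3) by blast
  then have "x \<in> V\<^sub>1" if "(u, x) \<in> (adj (E\<^sub>1 \<union> E\<^sub>2))\<^sup>*"
    using adj_rtrancl_restrict[OF that assms(5)] by blast
  moreover have "(u, x) \<in> (adj (E\<^sub>1 \<union> E\<^sub>2))\<^sup>*" if "x \<in> V\<^sub>1"
    using that assms(4,5) adj_rtrancl_mono[of u x E\<^sub>1] by (auto simp: graph_connected_adj)
  ultimately show "x \<in> {x. (u, x) \<in> (adj (E\<^sub>1 \<union> E\<^sub>2))\<^sup>*} \<longleftrightarrow> x \<in> V\<^sub>1" by blast
qed

text \<open>Betti numbers are nonnegative. Deleting an edge either keeps the graph connected or
  yields two connected pieces; in the second case the two units gained from the pieces are one for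
  the deleted edge and one for the bound itself.\<close>

lemma card_verts_le_Suc_card_edges:
  assumes "finite V" "edges_on V E" "graph_connected V E"
  shows "card V \<le> Suc (card E)"
  using assms
proof (induction "card E" arbitrary: V E rule: less_induct)
  case less
  have finE: "finite E"
    using less.prems(1,2) edges_on_subset[OF less.prems(2)] finite_subset[of E "Pow V"] by blast
  show ?case
  proof (cases "E = {}")
    case True
    then have "x = y" if "x \<in> V" "y \<in> V" for x y
      using that less.prems(3) by (auto simp: graph_connected_adj adj_def)
    then have "card V \<le> 1" using less.prems(1) by (auto simp: card_le_Suc0_iff_eq)
    then show ?thesis by simp
  next
    case False
    then obtain e where e: "e \<in> E" by blast
    then obtain u v where uv: "e = {u, v}" using less.prems(2) by (auto simp: edges_on_def)
    let ?E' = "E - {{u, v}}"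
    have uvE: "{u, v} \<in> E" using e uv by simp
    have cE: "card E = Suc (card ?E')" using finE uvE by (metis card.remove)
    show ?thesis
    proof (cases "graph_connected V ?E'")
      case True
      have "edges_on V ?E'" using less.prems by (auto simp: edges_on_def)
      then have "card V \<le> Suc (card ?E')"
        using less.hyps[of ?E' V] True less.prems cE by simp
      then show ?thesis using cE by simp
    next
      case False
      define C where "C = {x. (u, x) \<in> (adj ?E')\<^sup>*}"
      note split = graph_connected_bridge_split[OF less.prems(2,3) uvE False, folded C_def]
      define E1 where "E1 = {f \<in> ?E'. f \<subseteq> C}"
      define E2 where "E2 = {f \<in> ?E'. f \<subseteq> V - C}"
      have un: "?E' = E1 \<union> E2" using split(6) unfolding E1_def E2_def .
      \<comment> \<open>Only an empty edge could lie on both sides.\<close>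
      have dis: "E1 \<inter> E2 = {}"
        using edges_on_subset[OF less.prems(2)] unfolding E1_def E2_def by blast
      have fin: "finite E1" "finite E2" using finE un by (metis finite_Diff finite_Un)+
      have card': "card ?E' = card E1 + card E2"
        unfolding un using dis fin by (simp add: card_Un_disjoint)
      have eo: "edges_on C E1" "edges_on (V - C) E2"
        using edges_on_restrict[OF less.prems(2), of E1 C] edges_on_restrict[OF less.prems(2), of E2 "V - C"]
        unfolding E1_def E2_def by blast+
      have con: "graph_connected C E1" "graph_connected (V - C) E2"
        using split(4,5) unfolding E1_def E2_def .
      have finV: "finite C" "finite (V - C)"
        using split(2) less.prems(1) finite_subset by blast+
      have "card C \<le> Suc (card E1)"
        by (rule less.hyps) (use cE card' finV eo con in simp_all)
      moreover have "card (V - C) \<le> Suc (card E2)"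
        by (rule less.hyps) (use cE card' finV eo con in simp_all)
      moreover have "card V = card C + card (V - C)"
        using split(2) less.prems(1) finV card_mono[of V C]
        by (simp add: card_Diff_subset)
      ultimately show ?thesis using cE card' by simp
    qed
  qed
qed

section \<open>The edge deletion recurrence\<close>

text \<open>The two sides of a bridge live on arbitrary subsets of the colour classes, hence this
  generalisation of \<open>bip_verts\<close> beyond initial segments.\<close>

definition bverts :: "nat set \<Rightarrow> nat set \<Rightarrow> (nat + nat) set" where
  "bverts X Y = Inl ` X \<union> Inr ` Y"

definition bedges :: "nat set \<Rightarrow> nat set \<Rightarrow> (nat + nat) set set" where
  "bedges X Y = (\<lambda>(i, j). {Inl i, Inr j}) ` (X \<times> Y)"

definition bgraphs :: "nat set \<Rightarrow> nat set \<Rightarrow> nat \<Rightarrow> (nat + nat) set set set" where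
  "bgraphs X Y m = {E. E \<subseteq> bedges X Y \<and> graph_connected (bverts X Y) E \<and> card E = m}"

text \<open>Indexing by the number of edges makes deletion the step from \<open>Suc m\<close> to
  \<open>m\<close> and splitting a convolution over natural numbers. Betti numbers return in
  \<open>bcount_convolution\<close>.\<close>

definition bcount :: "nat \<Rightarrow> nat \<Rightarrow> nat \<Rightarrow> nat" where
  "bcount r s m = card (bgraphs {..<r} {..<s} m)"

lemma card_bedges: "card (bedges X Y) = card X * card Y"
proof -
  have "inj_on (\<lambda>(i, j). {Inl i, Inr j}) (X \<times> Y)"
    by (auto simp: inj_on_def doubleton_eq_iff)
  then show ?thesis unfolding bedges_def by (simp add: card_image card_cartesian_product)
qed

lemma finite_bedges: "finite X \<Longrightarrow> finite Y \<Longrightarrow> finite (bedges X Y)"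
  by (simp add: bedges_def)

lemma finite_bgraphs: "finite X \<Longrightarrow> finite Y \<Longrightarrow> finite (bgraphs X Y m)"
  by (rule finite_subset[of _ "Pow (bedges X Y)"]) (auto simp: bgraphs_def finite_bedges)

lemma edges_on_bedges: "E \<subseteq> bedges X Y \<Longrightarrow> edges_on (bverts X Y) E"
  unfolding edges_on_def
proof
  fix f assume "E \<subseteq> bedges X Y" "f \<in> E"
  then obtain i j where "f = {Inl i, Inr j}" "i \<in> X" "j \<in> Y"
    unfolding bedges_def by auto
  then show "\<exists>x y. f = {x, y} \<and> x \<in> bverts X Y \<and> y \<in> bverts X Y"
    by (intro exI[of _ "Inl i"] exI[of _ "Inr j"]) (simp add: bverts_def)
qed

lemma card_bverts: "finite X \<Longrightarrow> finite Y \<Longrightarrow> card (bverts X Y) = card X + card Y"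
  unfolding bverts_def by (subst card_Un_disjoint) (auto simp: card_image)

lemma bverts_eq_iff: "bverts X Y = bverts X' Y' \<longleftrightarrow> X = X' \<and> Y = Y'"
proof
  assume "bverts X Y = bverts X' Y'"
  then have "Inl -` bverts X Y = Inl -` bverts X' Y'" "Inr -` bverts X Y = Inr -` bverts X' Y'"
    by simp_all
  then show "X = X' \<and> Y = Y'" by (auto simp: bverts_def)
qed simp

lemma bverts_Diff: "bverts (X - X') (Y - Y') = bverts X Y - bverts X' Y'"
  by (auto simp: bverts_def)

lemma bedges_subset_bverts:
  assumes "f \<in> bedges X Y" "f \<subseteq> bverts X' Y'"
  shows "f \<in> bedges X' Y'"
  using assms by (auto simp: bedges_def bverts_def)

lemma bedges_mono: "X' \<subseteq> X \<Longrightarrow> Y' \<subseteq> Y \<Longrightarrow> bedges X' Y' \<subseteq> bedges X Y"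
  unfolding bedges_def by (intro image_mono Sigma_mono)

lemma graph_connected_image:
  assumes "graph_connected V E"
  shows "graph_connected (h ` V) ((`) h ` E)"
proof -
  have "(h x, h y) \<in> (adj ((`) h ` E))\<^sup>*" if "(x, y) \<in> (adj E)\<^sup>*" for x y
    using that
  proof (induction rule: rtrancl_induct)
    case base
    then show ?case by simp
  next
    case (step y z)
    then have "{y, z} \<in> E" by (simp add: adj_def)
    then have "h ` {y, z} \<in> (`) h ` E" by (rule imageI)
    then have "(h y, h z) \<in> adj ((`) h ` E)" by (simp add: adj_def)
    then show ?case using step by (meson rtrancl.rtrancl_into_rtrancl)
  qed
  note reach = this
  show ?thesis
    unfolding graph_connected_adj
  proof (intro conjI ballI)
    show "h ` V \<noteq> {}" using assms by (simp add: graph_connected_adj)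
    fix u v assume "u \<in> h ` V" "v \<in> h ` V"
    then obtain x y where "x \<in> V" "y \<in> V" "u = h x" "v = h y" by (elim imageE)
    then show "(u, v) \<in> (adj ((`) h ` E))\<^sup>*"
      using assms reach unfolding graph_connected_adj by simp
  qed
qed

text \<open>Relabelling the two colour classes maps graphs injectively. Applied to the inverse
  bijections as well, it gives the equality in \<open>card_bgraphs\<close>.\<close>

lemma card_bgraphs_le:
  assumes fin: "finite X'" "finite Y'"
    and f: "bij_betw f X X'" and g: "bij_betw g Y Y'"
  shows "card (bgraphs X Y m) \<le> card (bgraphs X' Y' m)"
proof (rule card_inj_on_le)
  let ?h = "map_sum f g"
  have im: "?h ` bverts X Y = bverts X' Y'"
  proof -
    have "?h ` bverts X Y = Inl ` (f ` X) \<union> Inr ` (g ` Y)"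
      by (simp add: bverts_def image_Un image_image)
    then show ?thesis using f g by (simp add: bij_betw_def bverts_def)
  qed
  have inj: "inj_on ?h (bverts X Y)"
  proof (rule inj_onI)
    fix a b assume ab: "a \<in> bverts X Y" "b \<in> bverts X Y" "?h a = ?h b"
    have mem: "Inl i \<in> bverts X Y \<longleftrightarrow> i \<in> X" "Inr i \<in> bverts X Y \<longleftrightarrow> i \<in> Y" for i
      by (auto simp: bverts_def)
    show "a = b"
      using ab by (cases a; cases b)
        (simp_all add: mem inj_on_eq_iff[OF bij_betw_imp_inj_on[OF f]]
          inj_on_eq_iff[OF bij_betw_imp_inj_on[OF g]])
  qed
  have sub: "bedges X Y \<subseteq> Pow (bverts X Y)"
    using edges_on_subset[OF edges_on_bedges[OF subset_refl, of X Y]] by (meson Pow_iff subsetI)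
  have inj1: "inj_on ((`) ?h) (Pow (bverts X Y))" using inj by (rule inj_on_image_Pow)
  then have inj2: "inj_on ((`) ((`) ?h)) (Pow (Pow (bverts X Y)))" by (rule inj_on_image_Pow)
  show "inj_on ((`) ((`) ?h)) (bgraphs X Y m)"
  proof (rule inj_on_subset[OF inj2], rule subsetI)
    fix E assume "E \<in> bgraphs X Y m"
    then have "E \<subseteq> bedges X Y" by (simp add: bgraphs_def)
    then show "E \<in> Pow (Pow (bverts X Y))" using sub by (meson PowI subset_trans)
  qed
  show "(`) ((`) ?h) ` bgraphs X Y m \<subseteq> bgraphs X' Y' m"
  proof (clarify)
    fix E assume "E \<in> bgraphs X Y m"
    then have E: "E \<subseteq> bedges X Y" "graph_connected (bverts X Y) E" "card E = m"
      by (auto simp: bgraphs_def)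
    have "(`) ?h ` bedges X Y \<subseteq> bedges X' Y'"
    proof (rule image_subsetI)
      fix e assume "e \<in> bedges X Y"
      then obtain i j where "e = {Inl i, Inr j}" "i \<in> X" "j \<in> Y" by (auto simp: bedges_def)
      then show "?h ` e \<in> bedges X' Y'"
        using bij_betwE[OF f] bij_betwE[OF g] by (force simp: bedges_def)
    qed
    then have "(`) ?h ` E \<subseteq> bedges X' Y'" using image_mono[OF E(1)] subset_trans by metis
    moreover have "graph_connected (bverts X' Y') ((`) ?h ` E)"
      using graph_connected_image[OF E(2), of ?h] im by simp
    moreover have "card ((`) ?h ` E) = m"
      using E sub inj_on_subset[OF inj1, of E] by (simp add: card_image subset_trans)
    ultimately show "(`) ?h ` E \<in> bgraphs X' Y' m" by (simp add: bgraphs_def)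
  qed
  show "finite (bgraphs X' Y' m)" using fin by (rule finite_bgraphs)
qed

lemma card_bgraphs:
  assumes "finite X" "finite Y"
  shows "card (bgraphs X Y m) = bcount (card X) (card Y) m"
proof -
  obtain f g where f: "bij_betw f X {..<card X}" and g: "bij_betw g Y {..<card Y}"
    using assms by (metis ex_bij_betw_finite_nat atLeast0LessThan)
  show ?thesis
    unfolding bcount_def
    using card_bgraphs_le[OF _ _ f g] card_bgraphs_le[OF assms bij_betw_inv_into[OF f] bij_betw_inv_into[OF g]]
    by (intro antisym) auto
qed

lemma bcount_eq_0:
  assumes "Suc m < r + s"
  shows "bcount r s m = 0"
proof -
  have False if "E \<in> bgraphs {..<r} {..<s} m" for E
  proof -
    have E: "E \<subseteq> bedges {..<r} {..<s}" "graph_connected (bverts {..<r} {..<s}) E" "card E = m"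
      using that by (auto simp: bgraphs_def)
    have "finite (bverts {..<r} {..<s})" by (simp add: bverts_def)
    from card_verts_le_Suc_card_edges[OF this edges_on_bedges[OF E(1)] E(2)]
    show False using assms E(3) by (simp add: card_bverts)
  qed
  then show ?thesis unfolding bcount_def by (metis card.empty equals0I)
qed

lemma N_bi_conv_bcount:
  assumes "int m = int r + int s + k - 1"
  shows "N_bi r s k = bcount r s m"
proof -
  have "complete_bip_edges r s = bedges {..<r} {..<s}"
    unfolding complete_bip_edges_def bedges_def by (auto simp: image_iff)
  moreover have "bip_verts r s = bverts {..<r} {..<s}"
    by (simp add: bip_verts_def bverts_def)
  ultimately show ?thesis
    using assms unfolding N_bi_def bcount_def bgraphs_def by (metis of_nat_eq_iff)
qed

lemma sum_Pow_card:
  fixes g :: "nat \<Rightarrow> nat"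
  assumes "finite X"
  shows "(\<Sum>A\<in>Pow X. g (card A)) = (\<Sum>a\<le>card X. (card X choose a) * g a)"
proof -
  have "(\<Sum>A\<in>Pow X. g (card A)) = (\<Sum>a\<le>card X. \<Sum>A\<in>{A \<in> Pow X. card A = a}. g (card A))"
    by (rule sum.group[symmetric]) (use assms in \<open>auto intro: card_mono\<close>)
  also have "\<dots> = (\<Sum>a\<le>card X. (card X choose a) * g a)"
    using n_subsets[OF assms] by (intro sum.cong) auto
  finally show ?thesis .
qed

text \<open>The data of a graph with a marked bridge and \<open>m\<close> further edges: the vertex
  set of the side of the \<open>Inl\<close> end, the edge sets of both sides, and the two ends. The
  colours of the ends order the two sides, so no factor 1/2 arises.\<close>

definition bsplits :: "nat set \<Rightarrow> nat set \<Rightarrow> nat \<Rightarrow>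
    ((nat set \<times> nat set) \<times> ((nat + nat) set set \<times> (nat + nat) set set) \<times> nat \<times> nat) set" where
  "bsplits X Y m = (SIGMA p : Pow X \<times> Pow Y.
     (\<Union>k\<le>m. bgraphs (fst p) (snd p) k \<times> bgraphs (X - fst p) (Y - snd p) (m - k)) \<times>
     (fst p \<times> (Y - snd p)))"

definition bjoin ::
    "(nat set \<times> nat set) \<times> ((nat + nat) set set \<times> (nat + nat) set set) \<times> nat \<times> nat \<Rightarrow>
      (nat + nat) set set \<times> (nat + nat) set" where
  "bjoin = (\<lambda>(p, (E\<^sub>1, E\<^sub>2), u, v). (insert {Inl u, Inr v} (E\<^sub>1 \<union> E\<^sub>2), {Inl u, Inr v}))"

lemma bsplitsD:
  assumes "((X', Y'), (E\<^sub>1, E\<^sub>2), u, v) \<in> bsplits X Y m" "finite X" "finite Y"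
  shows "X' \<subseteq> X" "Y' \<subseteq> Y" "u \<in> X'" "v \<in> Y - Y'"
    "E\<^sub>1 \<subseteq> bedges X' Y'" "E\<^sub>2 \<subseteq> bedges (X - X') (Y - Y')"
    "graph_connected (bverts X' Y') E\<^sub>1" "graph_connected (bverts (X - X') (Y - Y')) E\<^sub>2"
    "{Inl u, Inr v} \<notin> E\<^sub>1 \<union> E\<^sub>2" "E\<^sub>1 \<inter> E\<^sub>2 = {}" "card (E\<^sub>1 \<union> E\<^sub>2) = m"
    "{x. (Inl u, x) \<in> (adj (E\<^sub>1 \<union> E\<^sub>2))\<^sup>*} = bverts X' Y'"
proof -
  obtain k where k: "k \<le> m" "E\<^sub>1 \<in> bgraphs X' Y' k" "E\<^sub>2 \<in> bgraphs (X - X') (Y - Y') (m - k)"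
    and 1: "X' \<subseteq> X" "Y' \<subseteq> Y" "u \<in> X'" "v \<in> Y - Y'"
    using assms(1) unfolding bsplits_def by auto
  show "X' \<subseteq> X" "Y' \<subseteq> Y" "u \<in> X'" "v \<in> Y - Y'" by (fact 1)+
  show E: "E\<^sub>1 \<subseteq> bedges X' Y'" "E\<^sub>2 \<subseteq> bedges (X - X') (Y - Y')"
    and con: "graph_connected (bverts X' Y') E\<^sub>1" "graph_connected (bverts (X - X') (Y - Y')) E\<^sub>2"
    using k by (simp_all add: bgraphs_def)
  have fin: "finite X'" "finite Y'" using 1(1,2) assms(2,3) finite_subset by metis+
  have "{Inl u, Inr v} \<notin> bedges X' Y'" "{Inl u, Inr v} \<notin> bedges (X - X') (Y - Y')"
    using 1(3,4) by (auto simp: bedges_def doubleton_eq_iff)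
  then show "{Inl u, Inr v} \<notin> E\<^sub>1 \<union> E\<^sub>2" using E by (metis UnE subsetD)
  have "bedges X' Y' \<inter> bedges (X - X') (Y - Y') = {}"
    by (auto simp: bedges_def doubleton_eq_iff)
  then show dis: "E\<^sub>1 \<inter> E\<^sub>2 = {}" using E by (metis Int_mono subset_empty)
  have "finite E\<^sub>1" "finite E\<^sub>2"
    using E fin assms(2,3) finite_bedges finite_subset finite_Diff by metis+
  then show "card (E\<^sub>1 \<union> E\<^sub>2) = m"
    using dis k by (simp add: card_Un_disjoint bgraphs_def)
  show "{x. (Inl u, x) \<in> (adj (E\<^sub>1 \<union> E\<^sub>2))\<^sup>*} = bverts X' Y'"
  proof (rule reachable_disjoint_union)
    show "edges_on (bverts X' Y') E\<^sub>1" using E(1) by (rule edges_on_bedges)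
    show "edges_on (bverts (X - X') (Y - Y')) E\<^sub>2" using E(2) by (rule edges_on_bedges)
    show "bverts X' Y' \<inter> bverts (X - X') (Y - Y') = {}" by (simp add: bverts_Diff)
    show "Inl u \<in> bverts X' Y'" using 1(3) by (simp add: bverts_def)
  qed (fact con)
qed

lemma bverts_vimage: "C \<subseteq> bverts X Y \<Longrightarrow> C = bverts (Inl -` C) (Inr -` C)"
  by (auto simp: bverts_def)

text \<open>The marked edge gives \<open>u\<close> and \<open>v\<close>; the component of
  \<open>Inl u\<close> without that edge gives the vertex sets; intersecting with the possible edges
  of each side then separates the two edge sets.\<close>

lemma inj_on_bjoin:
  assumes "finite X" "finite Y"
  shows "inj_on bjoin (bsplits X Y m)"
proof (rule inj_onI)
  fix p q assume pq: "p \<in> bsplits X Y m" "q \<in> bsplits X Y m" "bjoin p = bjoin q"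
  obtain A B E F u v where p: "p = ((A, B), (E, F), u, v)" by (metis prod.exhaust)
  obtain A' B' E' F' u' v' where q: "q = ((A', B'), (E', F'), u', v')" by (metis prod.exhaust)
  note dp = bsplitsD[OF pq(1)[unfolded p] assms] and dq = bsplitsD[OF pq(2)[unfolded q] assms]
  have "insert {Inl u, Inr v} (E \<union> F) = insert {Inl u', Inr v'} (E' \<union> F') \<and>
      {Inl u, Inr v} = ({Inl u', Inr v'} :: (nat + nat) set)"
    using pq(3) unfolding bjoin_def p q prod.case prod.inject .
  then have ins: "insert {Inl u, Inr v} (E \<union> F) = insert {Inl u', Inr v'} (E' \<union> F')"
    and "{Inl u, Inr v} = ({Inl u', Inr v'} :: (nat + nat) set)" by (rule conjunct1, rule conjunct2)
  then have uv: "u = u'" "v = v'" by (metis doubleton_eq_iff sum.inject sum.distinct)+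
  have un: "E \<union> F = E' \<union> F'"
    using dp(9) dq(9) ins unfolding uv by (metis insert_ident)
  have "bverts A B = bverts A' B'" using dp(12) dq(12) un uv by simp
  then have AB: "A = A'" "B = B'" by (simp_all add: bverts_eq_iff)
  have disj: "bedges A B \<inter> bedges (X - A) (Y - B) = {}"
    by (auto simp: bedges_def doubleton_eq_iff)
  have "E = (E \<union> F) \<inter> bedges A B" "F = (E \<union> F) \<inter> bedges (X - A) (Y - B)"
    using dp(5,6) disj by (auto dest: subsetD)
  moreover have "E' = (E' \<union> F') \<inter> bedges A B" "F' = (E' \<union> F') \<inter> bedges (X - A) (Y - B)"
    using dq(5,6) disj unfolding AB by (auto dest: subsetD)
  ultimately have "E = E'" "F = F'" using un by metis+
  then show "p = q" using p q uv AB by simp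
qed

lemma bjoin_image:
  assumes fin: "finite X" "finite Y"
  shows "bjoin ` bsplits X Y m =
    {(E, e). E \<in> bgraphs X Y (Suc m) \<and> e \<in> E \<and> \<not> graph_connected (bverts X Y) (E - {e})}"
    (is "_ = ?S")
proof (intro equalityI subsetI)
  fix z assume "z \<in> bjoin ` bsplits X Y m"
  then obtain A B E F u v where z: "z = bjoin ((A, B), (E, F), u, v)"
    and mem: "((A, B), (E, F), u, v) \<in> bsplits X Y m" by auto
  note d = bsplitsD[OF mem fin]
  let ?e = "{Inl u, Inr v} :: (nat + nat) set"
  have V: "bverts X Y = bverts A B \<union> bverts (X - A) (Y - B)"
    using d(1,2) by (auto simp: bverts_def)
  have vB: "Inr v \<in> bverts (X - A) (Y - B)" using d(4) by (simp add: bverts_def)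
  have uA: "Inl u \<in> bverts A B" using d(3) by (simp add: bverts_def)
  have "finite (E \<union> F)"
    using d(1,2,5,6) fin finite_bedges finite_subset finite_Diff finite_UnI by metis
  then have "card (insert ?e (E \<union> F)) = Suc m" using d(9,11) by simp
  moreover have "insert ?e (E \<union> F) \<subseteq> bedges X Y"
  proof (intro insert_subsetI Un_least)
    show "?e \<in> bedges X Y" using d(1-4) by (auto simp: bedges_def)
    show "E \<subseteq> bedges X Y" using d(5) bedges_mono[OF d(1,2)] by (rule subset_trans)
    show "F \<subseteq> bedges X Y"
      using d(6) bedges_mono[OF Diff_subset Diff_subset] by (rule subset_trans)
  qed
  moreover have "graph_connected (bverts X Y) (insert ?e (E \<union> F))"
    unfolding V using d(7,8) uA vB by (rule graph_connected_join)
  moreover have "\<not> graph_connected (bverts X Y) (E \<union> F)"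
  proof
    assume "graph_connected (bverts X Y) (E \<union> F)"
    then have "(Inl u, Inr v) \<in> (adj (E \<union> F))\<^sup>*"
      using uA vB V by (auto simp: graph_connected_adj)
    then have "Inr v \<in> bverts A B" using d(12) by blast
    then show False using d(4) by (auto simp: bverts_def)
  qed
  moreover have "insert ?e (E \<union> F) - {?e} = E \<union> F" using d(9) by simp
  ultimately show "z \<in> ?S" unfolding z bjoin_def by (simp add: bgraphs_def)
next
  fix z assume "z \<in> ?S"
  then obtain E e where z: "z = (E, e)" and E: "E \<in> bgraphs X Y (Suc m)" and e: "e \<in> E"
    and ncon: "\<not> graph_connected (bverts X Y) (E - {e})" by auto
  have Eb: "E \<subseteq> bedges X Y" and con: "graph_connected (bverts X Y) E" and cE: "card E = Suc m"
    using E by (simp_all add: bgraphs_def)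
  obtain u v where uv: "e = {Inl u, Inr v}" "u \<in> X" "v \<in> Y"
    using Eb e by (auto simp: bedges_def)
  define C where "C = {x. (Inl u, x) \<in> (adj (E - {{Inl u, Inr v}}))\<^sup>*}"
  note split = graph_connected_bridge_split[OF edges_on_bedges[OF Eb] con e[unfolded uv(1)]
      ncon[unfolded uv(1)], folded C_def, folded uv(1)]
  define A where "A = Inl -` C"
  define B where "B = Inr -` C"
  have C: "C = bverts A B" unfolding A_def B_def by (rule bverts_vimage[OF split(2)])
  have VC: "bverts X Y - C = bverts (X - A) (Y - B)" by (simp add: C bverts_Diff)
  define E1 where "E1 = {f \<in> E - {e}. f \<subseteq> C}"
  define E2 where "E2 = {f \<in> E - {e}. f \<subseteq> bverts X Y - C}"
  have un: "E - {e} = E1 \<union> E2" unfolding E1_def E2_def by (rule split(6))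
  have E1b: "E1 \<subseteq> bedges A B"
  proof
    fix f assume "f \<in> E1"
    then have "f \<in> bedges X Y" "f \<subseteq> bverts A B" using Eb unfolding E1_def C by auto
    then show "f \<in> bedges A B" by (rule bedges_subset_bverts)
  qed
  have E2b: "E2 \<subseteq> bedges (X - A) (Y - B)"
  proof
    fix f assume "f \<in> E2"
    then have "f \<in> bedges X Y" "f \<subseteq> bverts (X - A) (Y - B)" using Eb unfolding E2_def VC by auto
    then show "f \<in> bedges (X - A) (Y - B)" by (rule bedges_subset_bverts)
  qed
  have dis: "E1 \<inter> E2 = {}"
  proof -
    have "bedges A B \<inter> bedges (X - A) (Y - B) = {}"
      by (auto simp: bedges_def doubleton_eq_iff)
    then show ?thesis using E1b E2b by (metis Int_mono subset_empty)
  qed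
  have finE: "finite E" using Eb fin finite_bedges finite_subset by metis
  then have "finite E1" "finite E2" by (simp_all add: E1_def E2_def)
  then have "card E1 + card E2 = m"
    using dis un cE e finE by (metis card_Un_disjoint card_Diff_singleton diff_Suc_1)
  moreover have "E1 \<in> bgraphs A B (card E1)"
    using E1b split(4) unfolding bgraphs_def C[symmetric] E1_def by simp
  moreover have "E2 \<in> bgraphs (X - A) (Y - B) (card E2)"
    using E2b split(5) unfolding bgraphs_def VC[symmetric] E2_def by simp
  ultimately have "(E1, E2) \<in> (\<Union>k\<le>m. bgraphs A B k \<times> bgraphs (X - A) (Y - B) (m - k))"
    by (intro UN_I[of "card E1"]) auto
  moreover have "A \<subseteq> X" "B \<subseteq> Y" using split(2) unfolding A_def B_def by (auto simp: bverts_def)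
  moreover have "u \<in> A" using split(1) by (simp add: A_def)
  moreover have "v \<in> Y - B" using split(3) uv(3) by (simp add: B_def)
  ultimately have "((A, B), (E1, E2), u, v) \<in> bsplits X Y m" by (simp add: bsplits_def)
  moreover have "z = bjoin ((A, B), (E1, E2), u, v)"
    unfolding bjoin_def z using un uv(1) e by (simp add: insert_absorb flip: un)
  ultimately show "z \<in> bjoin ` bsplits X Y m" by (metis imageI)
qed

text \<open>The summand depends on the chosen vertex sets only through their sizes \<open>a\<close>
  and \<open>b\<close>; the factor \<open>a * (card Y - b)\<close> counts the positions of the
  bridge.\<close>

lemma card_bsplits:
  assumes fin: "finite X" "finite Y"
  shows "card (bsplits X Y m) =
    (\<Sum>a\<le>card X. \<Sum>b\<le>card Y. (card X choose a) * (card Y choose b) * (a * (card Y - b)) *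
      (\<Sum>k\<le>m. bcount a b k * bcount (card X - a) (card Y - b) (m - k)))"
proof -
  define w where "w a b = (a * (card Y - b)) *
      (\<Sum>k\<le>m. bcount a b k * bcount (card X - a) (card Y - b) (m - k))" for a b
  let ?G = "\<lambda>A B. \<Union>k\<le>m. bgraphs A B k \<times> bgraphs (X - A) (Y - B) (m - k)"
  have G: "card (?G A B \<times> (A \<times> (Y - B))) = w (card A) (card B) \<and> finite (?G A B \<times> (A \<times> (Y - B)))"
    if AB: "A \<subseteq> X" "B \<subseteq> Y" for A B
  proof -
    have f: "finite A" "finite B" using AB fin finite_subset by metis+
    have "card (?G A B) = (\<Sum>k\<le>m. card (bgraphs A B k \<times> bgraphs (X - A) (Y - B) (m - k)))"
    proof (rule card_UN_disjoint)
      show "\<forall>i\<in>{..m}. finite (bgraphs A B i \<times> bgraphs (X - A) (Y - B) (m - i))"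
        using f fin by (simp add: finite_bgraphs)
      show "\<forall>i\<in>{..m}. \<forall>j\<in>{..m}. i \<noteq> j \<longrightarrow>
          bgraphs A B i \<times> bgraphs (X - A) (Y - B) (m - i) \<inter>
          bgraphs A B j \<times> bgraphs (X - A) (Y - B) (m - j) = {}"
        by (auto simp: bgraphs_def)
    qed simp
    also have "\<dots> = (\<Sum>k\<le>m. bcount (card A) (card B) k *
        bcount (card X - card A) (card Y - card B) (m - k))"
      using f fin AB by (simp add: card_cartesian_product card_bgraphs card_Diff_subset)
    finally have "card (?G A B) = \<dots>" .
    moreover have "finite (?G A B)" using f fin by (simp add: finite_bgraphs)
    ultimately show ?thesis
      using f fin AB by (simp add: card_cartesian_product w_def card_Diff_subset mult.commute)
  qed
  have "card (bsplits X Y m) = (\<Sum>p\<in>Pow X \<times> Pow Y. w (card (fst p)) (card (snd p)))"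
    unfolding bsplits_def
  proof (subst card_SigmaI)
    show "finite (Pow X \<times> Pow Y)" using fin by simp
    show "\<forall>p\<in>Pow X \<times> Pow Y. finite (?G (fst p) (snd p) \<times> (fst p \<times> (Y - snd p)))"
      using G by (auto simp del: finite_SigmaI2 finite_cartesian_product_iff)
    show "(\<Sum>p\<in>Pow X \<times> Pow Y. card (?G (fst p) (snd p) \<times> (fst p \<times> (Y - snd p)))) =
        (\<Sum>p\<in>Pow X \<times> Pow Y. w (card (fst p)) (card (snd p)))"
      using G by (intro sum.cong) (auto simp del: card_cartesian_product)
  qed
  also have "\<dots> = (\<Sum>A\<in>Pow X. \<Sum>B\<in>Pow Y. w (card A) (card B))"
    by (simp add: sum.cartesian_product case_prod_beta)
  also have "\<dots> = (\<Sum>a\<le>card X. (card X choose a) * (\<Sum>b\<le>card Y. (card Y choose b) * w a b))"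
    using sum_Pow_card[OF fin(2)] sum_Pow_card[OF fin(1), of "\<lambda>a. \<Sum>b\<le>card Y. (card Y choose b) * w a b"]
    by simp
  finally show ?thesis by (simp add: w_def sum_distrib_left mult_ac)
qed

text \<open>Double counting of pairs of a connected graph with \<open>Suc m\<close> edges and one of
  its edges. If the graph stays connected without the edge, the pair is a connected graph with
  \<open>m\<close> edges together with one of its \<open>r * s - m\<close> absent edges; otherwise
  it is a split counted by \<open>card_bsplits\<close>.\<close>

theorem bcount_Suc:
  "Suc m * bcount r s (Suc m) = (r * s - m) * bcount r s m +
    (\<Sum>a\<le>r. \<Sum>b\<le>s. (r choose a) * (s choose b) * (a * (s - b)) *
      (\<Sum>k\<le>m. bcount a b k * bcount (r - a) (s - b) (m - k)))"
proof -
  let ?X = "{..<r}" and ?Y = "{..<s}"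
  let ?G = "bgraphs ?X ?Y" and ?V = "bverts ?X ?Y" and ?K = "bedges ?X ?Y"
  let ?S1 = "{(E, e). E \<in> ?G (Suc m) \<and> e \<in> E \<and> graph_connected ?V (E - {e})}"
  let ?S2 = "{(E, e). E \<in> ?G (Suc m) \<and> e \<in> E \<and> \<not> graph_connected ?V (E - {e})}"
  let ?T = "SIGMA E : ?G m. ?K - E"
  have finG: "finite (?G k)" for k by (simp add: finite_bgraphs)
  have finK: "finite ?K" by (simp add: finite_bedges)
  have fG: "finite E" "card E = k" "E \<subseteq> ?K" if "E \<in> ?G k" for E k
    using that finite_subset[OF _ finK] by (auto simp: bgraphs_def)
  have un: "(SIGMA E : ?G (Suc m). E) = ?S1 \<union> ?S2" by auto
  have "finite (SIGMA E : ?G (Suc m). E)"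
    using finG fG(1) by (intro finite_SigmaI)
  then have "finite ?S1" "finite ?S2" unfolding un by (simp_all only: finite_Un)
  moreover have "?S1 \<inter> ?S2 = {}" by auto
  ultimately have "card (SIGMA E : ?G (Suc m). E) = card ?S1 + card ?S2"
    unfolding un by (rule card_Un_disjoint)
  moreover have "card (SIGMA E : ?G (Suc m). E) = Suc m * bcount r s (Suc m)"
    using finG fG by (subst card_SigmaI) (simp_all add: bcount_def)
  moreover have "card ?S2 = card (bsplits ?X ?Y m)"
    using card_image[OF inj_on_bjoin[of ?X ?Y m]] bjoin_image[of ?X ?Y m] by simp
  moreover have "card ?S1 = card ?T"
  proof (rule bij_betw_same_card[symmetric])
    show "bij_betw (\<lambda>(E, e). (insert e E, e)) ?T ?S1"
    proof (rule bij_betw_byWitness[where f' = "\<lambda>(E, e). (E - {e}, e)"])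
      show "\<forall>a\<in>?T. (case case a of (E, e) \<Rightarrow> (insert e E, e) of (E, e) \<Rightarrow> (E - {e}, e)) = a" by auto
      show "\<forall>a'\<in>?S1. (case case a' of (E, e) \<Rightarrow> (E - {e}, e) of (E, e) \<Rightarrow> (insert e E, e)) = a'"
        by auto
      show "(\<lambda>(E, e). (insert e E, e)) ` ?T \<subseteq> ?S1"
      proof (rule image_subsetI)
        fix z assume "z \<in> ?T"
        then obtain E e where z: "z = (E, e)" "E \<in> ?G m" "e \<in> ?K" "e \<notin> E" by auto
        then have "insert e E \<in> ?G (Suc m)"
          using fG[OF z(2)] graph_connected_mono[OF _ subset_insertI] by (simp add: bgraphs_def)
        then show "(case z of (E, e) \<Rightarrow> (insert e E, e)) \<in> ?S1"
          using z by (simp add: bgraphs_def)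
      qed
      show "(\<lambda>(E, e). (E - {e}, e)) ` ?S1 \<subseteq> ?T"
      proof (rule image_subsetI)
        fix z assume "z \<in> ?S1"
        then obtain E e where z: "z = (E, e)" "E \<in> ?G (Suc m)" "e \<in> E" "graph_connected ?V (E - {e})"
          by auto
        then have "E - {e} \<in> ?G m" "e \<in> ?K"
          using fG[OF z(2)] by (auto simp: bgraphs_def)
        then show "(case z of (E, e) \<Rightarrow> (E - {e}, e)) \<in> ?T" using z by simp
      qed
    qed
  qed
  moreover have "card ?T = (r * s - m) * bcount r s m"
    using finG fG finK by (subst card_SigmaI) (simp_all add: card_Diff_subset card_bedges bcount_def)
  ultimately show ?thesis by (simp add: card_bsplits)
qed

section \<open>From numbers of edges to Betti numbers\<close>

lemma bcount_eq_0_of_many_edges: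
  assumes "r * s < m"
  shows "bcount r s m = 0"
proof -
  have "bgraphs {..<r} {..<s} m = {}"
  proof (rule equals0I)
    fix E assume "E \<in> bgraphs {..<r} {..<s} m"
    then have "E \<subseteq> bedges {..<r} {..<s}" "card E = m" by (simp_all add: bgraphs_def)
    then show False using card_mono[OF finite_bedges, of "{..<r}" "{..<s}" E] assms
      by (simp add: card_bedges)
  qed
  then show ?thesis by (simp add: bcount_def)
qed

text \<open>A side with \<open>a + b\<close> vertices and Betti number \<open>j\<close> has
  \<open>j + a + b - 1\<close> edges. The two subtracted units account for \<open>m + 2\<close>, and
  all terms outside this range of edge numbers would have a side with a negative Betti
  number.\<close>

lemma bcount_convolution:
  assumes "a + b > 0" "a' + b' > 0" "m + 2 = a + b + a' + b' + k"
  shows "(\<Sum>i\<le>m. bcount a b i * bcount a' b' (m - i)) =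
    (\<Sum>j\<le>k. N_bi a b (int j) * N_bi a' b' (int (k - j)))"
proof -
  define h where "h = a + b - 1"
  have h: "h + 1 = a + b" using assms(1) by (simp add: h_def)
  have "(\<Sum>j\<le>k. N_bi a b (int j) * N_bi a' b' (int (k - j))) =
      (\<Sum>j\<in>{..k}. bcount a b (j + h) * bcount a' b' (m - (j + h)))"
  proof (rule sum.cong)
    fix j assume j: "j \<in> {..k}"
    have "N_bi a b (int j) = bcount a b (j + h)"
      by (rule N_bi_conv_bcount) (use h in linarith)
    moreover have "N_bi a' b' (int (k - j)) = bcount a' b' (m - (j + h))"
      by (rule N_bi_conv_bcount) (use h j assms in auto)
    ultimately show "N_bi a b (int j) * N_bi a' b' (int (k - j)) =
        bcount a b (j + h) * bcount a' b' (m - (j + h))" by simp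
  qed simp
  also have "\<dots> = (\<Sum>i\<in>(\<lambda>j. j + h) ` {..k}. bcount a b i * bcount a' b' (m - i))"
    by (subst sum.reindex) (auto simp: o_def)
  also have "\<dots> = (\<Sum>i\<le>m. bcount a b i * bcount a' b' (m - i))"
  proof (rule sum.mono_neutral_left)
    show "(\<lambda>j. j + h) ` {..k} \<subseteq> {..m}" using h assms by auto
    show "\<forall>i\<in>{..m} - (\<lambda>j. j + h) ` {..k}. bcount a b i * bcount a' b' (m - i) = 0"
    proof
      fix i assume i: "i \<in> {..m} - (\<lambda>j. j + h) ` {..k}"
      then have "\<not> (h \<le> i \<and> i \<le> k + h)"
        by (metis DiffD2 atMost_iff image_eqI le_add_diff_inverse2 add_le_cancel_right)
      then have "Suc i < a + b \<or> Suc (m - i) < a' + b'"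
        using i h assms by auto
      then show "bcount a b i * bcount a' b' (m - i) = 0"
        using bcount_eq_0[of i a b] bcount_eq_0[of "m - i" a' b'] by auto
    qed
  qed simp
  finally show ?thesis by simp
qed

lemma N_bi_recurrence:
  "(real r + real s + real k - 1) * real (N_bi r s (int k)) =
     (if k = 0 then 0
      else (real r * real s - (real r + real s + real k - 2)) * real (N_bi r s (int (k - 1)))) +
     (\<Sum>a\<le>r. \<Sum>b\<le>s. real (r choose a) * real (s choose b) * (real a * real (s - b)) *
       (\<Sum>j\<le>k. real (N_bi a b (int j)) * real (N_bi (r - a) (s - b) (int (k - j)))))"
proof (cases "r + s + k \<ge> 2")
  case True
  define m where "m = r + s + k - 2"
  have m: "m + 2 = r + s + k" using True by (simp add: m_def)
  have N: "N_bi r s (int k) = bcount r s (Suc m)"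
    by (rule N_bi_conv_bcount) (use m in linarith)
  have conv: "real a * real (s - b) * real (\<Sum>i\<le>m. bcount a b i * bcount (r - a) (s - b) (m - i)) =
      real a * real (s - b) *
        (\<Sum>j\<le>k. real (N_bi a b (int j)) * real (N_bi (r - a) (s - b) (int (k - j))))"
    if "a \<le> r" "b \<le> s" for a b
  \<comment> \<open>When the factor in front is nonzero, each side contains an end of the bridge, so
    both sides are nonempty as \<open>bcount_convolution\<close> requires.\<close>
  proof (cases "a = 0 \<or> b = s")
    case False
    then have "(\<Sum>i\<le>m. bcount a b i * bcount (r - a) (s - b) (m - i)) =
        (\<Sum>j\<le>k. N_bi a b (int j) * N_bi (r - a) (s - b) (int (k - j)))"
      using that m by (intro bcount_convolution) auto
    then show ?thesis by simp
  qed auto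
  have first: "real ((r * s - m) * bcount r s m) =
     (if k = 0 then 0
      else (real r * real s - (real r + real s + real k - 2)) * real (N_bi r s (int (k - 1))))"
  \<comment> \<open>For \<open>k = 0\<close> the middle term disappears because
    \<open>r + s - 2\<close> edges cannot connect \<open>r + s\<close> vertices.\<close>
  proof (cases "k = 0")
    case True
    then show ?thesis using m bcount_eq_0[of m r s] by simp
  next
    case False
    then have "N_bi r s (int (k - 1)) = bcount r s m"
      by (intro N_bi_conv_bcount) (use m in linarith)
    moreover have "real m = real r + real s + real k - 2" using m by linarith
    moreover have "real ((r * s - m) * bcount r s m) = (real r * real s - real m) * real (bcount r s m)"
      using bcount_eq_0_of_many_edges[of r s m] by (cases "m \<le> r * s") (auto simp: of_nat_diff)
    ultimately show ?thesis using False by simp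
  qed
  have "(real r + real s + real k - 1) * real (N_bi r s (int k)) = real (Suc m * bcount r s (Suc m))"
  proof -
    have "real (Suc m) = real r + real s + real k - 1" using m by linarith
    then show ?thesis by (simp only: of_nat_mult N)
  qed
  also have "\<dots> = real ((r * s - m) * bcount r s m) +
      (\<Sum>a\<le>r. \<Sum>b\<le>s. real (r choose a) * real (s choose b) *
        (real a * real (s - b) * real (\<Sum>i\<le>m. bcount a b i * bcount (r - a) (s - b) (m - i))))"
    unfolding bcount_Suc of_nat_add of_nat_sum of_nat_mult by (simp only: mult.assoc)
  also have "\<dots> = real ((r * s - m) * bcount r s m) +
      (\<Sum>a\<le>r. \<Sum>b\<le>s. real (r choose a) * real (s choose b) *
        (real a * real (s - b) *
        (\<Sum>j\<le>k. real (N_bi a b (int j)) * real (N_bi (r - a) (s - b) (int (k - j))))))"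
    by (intro arg_cong2[where f = "(+)"] sum.cong refl arg_cong2[where f = "(*)"] conv) auto
  finally show ?thesis unfolding first by (simp only: mult.assoc)
next
  case False
  \<comment> \<open>Both sides vanish here: without vertices there is no connected graph, and for a
    single vertex with \<open>k = 0\<close> the factor \<open>r + s + k - 1\<close> is zero.\<close>
  then have rs: "r = 0 \<or> s = 0" "r * s = 0" by auto
  have zero: "real a * real (s - b) = 0" if "a \<le> r" for a b using that rs by auto
  then have "(\<Sum>a\<le>r. \<Sum>b\<le>s. real (r choose a) * real (s choose b) * (real a * real (s - b)) *
       (\<Sum>j\<le>k. real (N_bi a b (int j)) * real (N_bi (r - a) (s - b) (int (k - j))))) = 0"
    by (intro sum.neutral ballI) (simp only: atMost_iff zero mult_zero_left mult_zero_right)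
  moreover have "r = 0 \<and> s = 0 \<or> k = 0 \<and> r + s = 1" using False by auto
  ultimately show ?thesis using N_bi_degenerate[OF rs(2)] by auto
qed

lemma sum_rotate:
  "(\<Sum>a\<in>A. \<Sum>b\<in>B. \<Sum>c\<in>C. g a b c) = (\<Sum>c\<in>C. \<Sum>a\<in>A. \<Sum>b\<in>B. g a b c)"
proof -
  have "(\<Sum>a\<in>A. \<Sum>b\<in>B. \<Sum>c\<in>C. g a b c) = (\<Sum>a\<in>A. \<Sum>c\<in>C. \<Sum>b\<in>B. g a b c)"
    by (intro sum.cong refl sum.swap)
  also have "\<dots> = (\<Sum>c\<in>C. \<Sum>a\<in>A. \<Sum>b\<in>B. g a b c)" by (rule sum.swap)
  finally show ?thesis .
qed

section \<open>Generating functions in two variables and their differential equations\<close>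

definition N_egf :: "nat \<Rightarrow> nat \<Rightarrow> nat \<Rightarrow> real" where
  "N_egf k r s = real (N_bi r s (int k)) / (fact r * fact s)"

lemma N_egf_recurrence:
  "(real r + real s + real k - 1) * N_egf k r s =
     (if k = 0 then 0
      else (real r * real s - (real r + real s + real k - 2)) * N_egf (k - 1) r s) +
     (\<Sum>j\<le>k. \<Sum>a\<le>r. \<Sum>b\<le>s. real a * N_egf j a b * (real (s - b) * N_egf (k - j) (r - a) (s - b)))"
proof -
  let ?F = "fact r * fact s :: real"
  have F: "?F \<noteq> 0" by simp
  have summand: "real (r choose a) * real (s choose b) * (real a * real (s - b)) *
       (\<Sum>j\<le>k. real (N_bi a b (int j)) * real (N_bi (r - a) (s - b) (int (k - j)))) =
     ?F * (\<Sum>j\<le>k. real a * N_egf j a b * (real (s - b) * N_egf (k - j) (r - a) (s - b)))"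
    if "a \<le> r" "b \<le> s" for a b
  proof -
    have bin: "real (r choose a) = fact r / (fact a * fact (r - a))"
      "real (s choose b) = fact s / (fact b * fact (s - b))"
      using that by (simp_all add: binomial_fact)
    show ?thesis
      unfolding bin sum_distrib_left by (intro sum.cong refl) (simp add: N_egf_def field_simps)
  qed
  have "?F * ((real r + real s + real k - 1) * N_egf k r s) =
      (real r + real s + real k - 1) * real (N_bi r s (int k))"
    by (simp add: N_egf_def)
  also have "\<dots> = (if k = 0 then 0
      else (real r * real s - (real r + real s + real k - 2)) * real (N_bi r s (int (k - 1)))) +
      (\<Sum>a\<le>r. \<Sum>b\<le>s. ?F * (\<Sum>j\<le>k. real a * N_egf j a b * (real (s - b) * N_egf (k - j) (r - a) (s - b))))"
    unfolding N_bi_recurrence by (intro arg_cong2[where f = "(+)"] sum.cong refl summand) auto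
  also have "\<dots> = ?F * ((if k = 0 then 0
      else (real r * real s - (real r + real s + real k - 2)) * N_egf (k - 1) r s) +
      (\<Sum>a\<le>r. \<Sum>b\<le>s. \<Sum>j\<le>k. real a * N_egf j a b * (real (s - b) * N_egf (k - j) (r - a) (s - b))))"
    by (simp add: N_egf_def distrib_left sum_distrib_left)
  finally have "(real r + real s + real k - 1) * N_egf k r s =
     (if k = 0 then 0
      else (real r * real s - (real r + real s + real k - 2)) * N_egf (k - 1) r s) +
     (\<Sum>a\<le>r. \<Sum>b\<le>s. \<Sum>j\<le>k. real a * N_egf j a b * (real (s - b) * N_egf (k - j) (r - a) (s - b)))"
    using F mult_left_cancel by blast
  also have "(\<Sum>a\<le>r. \<Sum>b\<le>s. \<Sum>j\<le>k. real a * N_egf j a b * (real (s - b) * N_egf (k - j) (r - a) (s - b))) =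
      (\<Sum>j\<le>k. \<Sum>a\<le>r. \<Sum>b\<le>s. real a * N_egf j a b * (real (s - b) * N_egf (k - j) (r - a) (s - b)))"
    by (rule sum_rotate)
  finally show ?thesis .
qed

text \<open>
  The bivariate series with coefficients \<open>f r s\<close> at \<open>x\<^sup>r y\<^sup>s\<close>, written with \<open>x = q z\<close> and
  \<open>y = z\<close>: a power series in \<open>z\<close> with polynomial coefficients in \<open>q\<close>. Thus \<open>dq\<close> below is
  \<open>x d/dx\<close>, \<open>theta\<close> is \<open>x d/dx + y d/dy\<close> and \<open>dq'\<close> is \<open>y d/dy\<close>.
\<close>

definition bgf :: "(nat \<Rightarrow> nat \<Rightarrow> real) \<Rightarrow> real poly fps" where
  "bgf f = Abs_fps (\<lambda>n. \<Sum>r\<le>n. monom (f r (n - r)) r)"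

lemma coeff_bgf: "coeff (fps_nth (bgf f) n) r = (if r \<le> n then f r (n - r) else 0)"
  by (simp add: bgf_def coeff_sum if_distrib sum.delta cong: if_cong)

lemma bgf_add: "bgf f + bgf g = bgf (\<lambda>r s. f r s + g r s)"
  by (intro fps_ext poly_eqI) (simp add: coeff_bgf)

lemma bgf_diff: "bgf f - bgf g = bgf (\<lambda>r s. f r s - g r s)"
  by (intro fps_ext poly_eqI) (simp add: coeff_bgf)

lemma bgf_zero: "bgf (\<lambda>r s. 0) = 0"
  by (intro fps_ext poly_eqI) (simp add: coeff_bgf)

lemma bgf_mult:
  "bgf f * bgf g = bgf (\<lambda>r s. \<Sum>a\<le>r. \<Sum>b\<le>s. f a b * g (r - a) (s - b))"
proof (intro fps_ext poly_eqI)
  fix n r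
  let ?c = "\<lambda>i a. (if a \<le> i then f a (i - a) else 0) * (if r - a \<le> n - i then g (r - a) (n - i - (r - a)) else 0)"
  have "coeff (fps_nth (bgf f * bgf g) n) r = (\<Sum>i=0..n. \<Sum>a\<le>r. ?c i a)"
    by (simp add: fps_mult_nth coeff_sum coeff_mult coeff_bgf)
  also have "\<dots> = (\<Sum>a\<le>r. \<Sum>i=0..n. ?c i a)" by (rule sum.swap)
  also have "\<dots> = (\<Sum>a\<le>r. if r \<le> n then \<Sum>b\<le>n - r. f a b * g (r - a) (n - r - b) else 0)"
  proof (rule sum.cong)
    fix a assume a: "a \<in> {..r}"
    show "(\<Sum>i=0..n. ?c i a) = (if r \<le> n then \<Sum>b\<le>n - r. f a b * g (r - a) (n - r - b) else 0)"
    proof (cases "r \<le> n")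
      case True
      have "(\<Sum>b\<le>n - r. f a b * g (r - a) (n - r - b)) = (\<Sum>b\<le>n - r. ?c (a + b) a)"
        using a True by (intro sum.cong) (auto intro!: arg_cong2[where f = g])
      also have "\<dots> = (\<Sum>i\<in>(+) a ` {..n - r}. ?c i a)"
        by (subst sum.reindex) auto
      also have "\<dots> = (\<Sum>i=0..n. ?c i a)"
      proof (rule sum.mono_neutral_left)
        show "(+) a ` {..n - r} \<subseteq> {0..n}" using a True by auto
        show "\<forall>i\<in>{0..n} - (+) a ` {..n - r}. ?c i a = 0"
        proof
          fix i assume i: "i \<in> {0..n} - (+) a ` {..n - r}"
          have "\<not> (a \<le> i \<and> i - a \<le> n - r)"
          proof
            assume "a \<le> i \<and> i - a \<le> n - r"
            then have "i \<in> (+) a ` {..n - r}" by (intro image_eqI[of _ _ "i - a"]) auto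
            then show False using i by simp
          qed
          then have "\<not> (a \<le> i \<and> r - a \<le> n - i)" using a True i by auto
          then show "?c i a = 0" by auto
        qed
      qed simp
      finally show ?thesis using True by simp
    next
      case False
      then have "?c i a = 0" if "i \<le> n" for i using a that by auto
      then show ?thesis using False by (simp add: sum.neutral)
    qed
  qed simp
  also have "\<dots> = coeff (fps_nth (bgf (\<lambda>r s. \<Sum>a\<le>r. \<Sum>b\<le>s. f a b * g (r - a) (s - b))) n) r"
    by (simp add: coeff_bgf)
  finally show "coeff (fps_nth (bgf f * bgf g) n) r = \<dots>" .
qed

definition theta :: "'a::comm_ring_1 fps \<Rightarrow> 'a fps" where
  "theta f = fps_X * fps_deriv f"

definition dq :: "real poly fps \<Rightarrow> real poly fps" where
  "dq F = Abs_fps (\<lambda>n. [:0, 1:] * pderiv (fps_nth F n))"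

definition dq' :: "real poly fps \<Rightarrow> real poly fps" where
  "dq' F = theta F - dq F"

lemma theta_nth: "fps_nth (theta f) n = of_nat n * fps_nth f n"
  by (cases n) (simp_all add: theta_def)

lemma theta_add: "theta (f + g) = theta f + theta g"
  and theta_diff: "theta (f - g) = theta f - theta g"
  and theta_mult: "theta (f * g) = theta f * g + f * theta g"
  and theta_1: "theta 1 = 0"
  and theta_numeral: "theta (numeral k) = 0"
  unfolding theta_def by (simp_all add: algebra_simps fps_numeral_fps_const)

lemma dq_add: "dq (f + g) = dq f + dq g"
  and dq_diff: "dq (f - g) = dq f - dq g"
  and dq_1: "dq 1 = 0"
  and dq_numeral: "dq (numeral k) = 0"
  by (auto simp: dq_def fps_eq_iff pderiv_add pderiv_diff smult_diff_right smult_add_right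
     pderiv_1 fps_numeral_nth)

lemma dq_mult: "dq (f * g) = dq f * g + f * dq g"
proof (rule fps_ext)
  fix n
  have "pderiv (\<Sum>i\<in>A. h i) = (\<Sum>i\<in>A. pderiv (h i))" for A and h :: "nat \<Rightarrow> real poly"
    by (induction A rule: infinite_finite_induct) (simp_all add: pderiv_add)
  then show "fps_nth (dq (f * g)) n = fps_nth (dq f * g + f * dq g) n"
    by (simp only: dq_def fps_nth_Abs_fps fps_mult_nth fps_add_nth pderiv_mult sum_distrib_left
         sum.distrib[symmetric]) (simp only: algebra_simps)
qed

lemma dq'_add: "dq' (f + g) = dq' f + dq' g"
  and dq'_diff: "dq' (f - g) = dq' f - dq' g"
  and dq'_1: "dq' 1 = 0"
  and dq'_numeral: "dq' (numeral k) = 0"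
  and dq'_mult: "dq' (f * g) = dq' f * g + f * dq' g"
  unfolding dq'_def
  by (simp_all add: theta_add dq_add theta_diff dq_diff theta_1 dq_1
      theta_numeral dq_numeral theta_mult dq_mult algebra_simps)

lemma theta_eq: "theta f = dq f + dq' f"
  by (simp add: dq'_def)

lemma coeff_dq: "coeff (fps_nth (dq F) n) r = real r * coeff (fps_nth F n) r"
  by (cases r) (simp_all add: dq_def coeff_pderiv)

lemma coeff_theta: "coeff (fps_nth (theta F) n) r = real n * coeff (fps_nth F n) r" for F :: "real poly fps"
  by (simp add: theta_nth of_nat_poly)

lemma dq_dq': "dq (dq' F) = dq' (dq F)"
  by (intro fps_ext poly_eqI) (simp add: dq'_def coeff_dq coeff_theta algebra_simps)

lemma dq_bgf: "dq (bgf f) = bgf (\<lambda>r s. real r * f r s)"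
  by (intro fps_ext poly_eqI) (simp add: coeff_dq coeff_bgf)

lemma dq'_bgf: "dq' (bgf f) = bgf (\<lambda>r s. real s * f r s)"
  by (intro fps_ext poly_eqI) (auto simp: dq'_def coeff_dq coeff_theta coeff_bgf of_nat_diff algebra_simps)

lemma bgf_recurrence:
  "bgf (\<lambda>r s. (real r + real s + real k - 1) * N_egf k r s) =
   bgf (\<lambda>r s. if k = 0 then 0
      else (real r * real s - (real r + real s + real k - 2)) * N_egf (k - 1) r s) +
   (\<Sum>j\<le>k. dq (bgf (N_egf j)) * dq' (bgf (N_egf (k - j))))"
proof -
  have sum: "bgf (\<lambda>r s. \<Sum>j\<in>A. h j r s) = (\<Sum>j\<in>A. bgf (h j))" for A and h :: "nat \<Rightarrow> nat \<Rightarrow> nat \<Rightarrow> real"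
    by (induction A rule: infinite_finite_induct) (simp_all add: bgf_zero bgf_add[symmetric])
  show ?thesis
    unfolding N_egf_recurrence bgf_add[symmetric] sum dq_bgf dq'_bgf bgf_mult ..
qed

definition "tree_egf = bgf (N_egf 0)"
definition "unicyclic_egf = bgf (N_egf 1)"
definition "bicyclic_egf = bgf (N_egf 2)"

lemma bgf_degree_shift:
  "bgf (\<lambda>r s. (real r + real s + c) * f r s) = theta (bgf f) + bgf (\<lambda>r s. c * f r s)"
  by (simp add: theta_eq dq_bgf dq'_bgf bgf_add algebra_simps)

lemma bgf_nonedges:
  "bgf (\<lambda>r s. (real r * real s - (real r + real s + c)) * f r s) =
    dq (dq' (bgf f)) - theta (bgf f) - bgf (\<lambda>r s. c * f r s)"
  by (simp add: theta_eq dq_bgf dq'_bgf bgf_add bgf_diff algebra_simps)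

lemma bgf_minus: "bgf (\<lambda>r s. - f r s) = - bgf f"
  by (intro fps_ext poly_eqI) (simp add: coeff_bgf)

lemma tree_egf_eq: "theta tree_egf - tree_egf = dq tree_egf * dq' tree_egf"
  using bgf_recurrence[of 0] bgf_degree_shift[of "- 1" "N_egf 0"]
  by (simp add: bgf_zero bgf_minus tree_egf_def)

lemma unicyclic_egf_eq: "theta unicyclic_egf = dq (dq' tree_egf) - theta tree_egf + tree_egf + dq tree_egf * dq' unicyclic_egf + dq unicyclic_egf * dq' tree_egf"
  using bgf_recurrence[of 1] bgf_degree_shift[of 0 "N_egf 1"] bgf_nonedges[of "- 1" "N_egf 0"]
  by (simp add: bgf_zero bgf_minus tree_egf_def unicyclic_egf_def ac_simps)

lemma bicyclic_egf_eq:
  "theta bicyclic_egf + bicyclic_egf = dq (dq' unicyclic_egf) - theta unicyclic_egf + dq tree_egf * dq' bicyclic_egf + dq unicyclic_egf * dq' unicyclic_egf + dq bicyclic_egf * dq' tree_egf"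
  using bgf_recurrence[of 2] bgf_degree_shift[of 1 "N_egf 2"] bgf_nonedges[of 0 "N_egf 1"]
  by (simp add: bgf_zero tree_egf_def unicyclic_egf_def bicyclic_egf_def numeral_2_eq_2 ac_simps)

section \<open>The equations for trees, unicyclic and bicyclic graphs\<close>

definition vanishes :: "nat \<Rightarrow> 'a::comm_ring_1 fps \<Rightarrow> bool" where
  "vanishes n F \<longleftrightarrow> (\<forall>i<n. fps_nth F i = 0)"

lemma vanishes_add: "vanishes n F \<Longrightarrow> vanishes n G \<Longrightarrow> vanishes n (F + G)"
  and vanishes_diff: "vanishes n F \<Longrightarrow> vanishes n G \<Longrightarrow> vanishes n (F - G)"
  by (simp_all add: vanishes_def)

lemma vanishes_mult: "fps_nth G 0 = 0 \<Longrightarrow> vanishes n F \<Longrightarrow> vanishes (Suc n) (G * F)"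
  unfolding vanishes_def fps_mult_nth
proof (intro allI impI sum.neutral ballI)
  fix i j assume *: "fps_nth G 0 = 0" "\<forall>i<n. fps_nth F i = 0" "i < Suc n" "j \<in> {0..i}"
  show "fps_nth G j * fps_nth F (i - j) = 0"
    using * by (cases "j = 0") auto
qed

lemma vanishes_dq: "vanishes n F \<Longrightarrow> vanishes n (dq F)"
  by (simp add: vanishes_def dq_def)

lemma vanishes_theta: "vanishes n F \<Longrightarrow> vanishes n (theta F)"
  by (simp add: vanishes_def theta_nth)

lemma vanishes_dq': "vanishes n F \<Longrightarrow> vanishes n (dq' F)"
  by (simp add: dq'_def vanishes_diff vanishes_dq vanishes_theta)

lemma vanishes_all: "(\<And>n. vanishes n F) \<Longrightarrow> F = 0"
  by (intro fps_ext) (auto simp: vanishes_def)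

text \<open>\<open>theta F - of_nat c * F\<close> has the coefficient of degree \<open>n\<close>
  multiplied by \<open>n - c\<close>, which is nonzero for \<open>n > c\<close>. Uniqueness proofs
  built on this start by checking the coefficients up to degree \<open>c\<close> directly.\<close>

lemma vanishes_step:
  fixes F :: "'a::{idom, ring_char_0} fps"
  assumes "vanishes n F" "c < n" "vanishes (Suc n) (theta F - of_nat c * F)"
  shows "vanishes (Suc n) F"
proof -
  have "fps_nth (theta F - of_nat c * F) n = (of_nat n - of_nat c) * fps_nth F n"
    by (simp add: theta_nth algebra_simps fps_of_nat[symmetric] del: fps_of_nat)
  moreover have "fps_nth (theta F - of_nat c * F) n = 0" using assms(3) by (simp add: vanishes_def)
  moreover have "(of_nat n - of_nat c :: 'a) \<noteq> 0" using assms(2) by simp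
  ultimately have "fps_nth F n = 0" by (metis mult_eq_0_iff)
  then show ?thesis using assms(1) by (auto simp: vanishes_def less_Suc_eq)
qed

text \<open>\<open>[:1, 1:]\<close> is q + 1, standing for x + y, the two trees with one vertex. It
  has to be prescribed because degree 1 cancels in \<open>theta F0 - F0\<close>; likewise
  \<open>theta F1\<close> leaves the constant term of \<open>F1\<close> open.\<close>

locale bicolored_series =
  fixes F0 F1 F2 :: "real poly fps"
  assumes F0_eq: "theta F0 - F0 = dq F0 * dq' F0"
    and F1_eq: "theta F1 = dq (dq' F0) - theta F0 + F0 + dq F0 * dq' F1 + dq F1 * dq' F0"
    and F2_eq: "theta F2 + F2 = dq (dq' F1) - theta F1 + dq F0 * dq' F2 + dq F1 * dq' F1 + dq F2 * dq' F0"
    and F0_0: "fps_nth F0 0 = 0" and F0_1: "fps_nth F0 1 = [:1, 1:]"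
    and F1_0: "fps_nth F1 0 = 0"
begin

text \<open>\<open>P\<close>, \<open>Q\<close>, \<open>R\<close> are the second derivatives of the
  tree series. \<open>J\<close> is going to be 1/(1 - \<open>Z\<close>), see \<open>J_mult\<close>;
  the form \<open>1 + Q\<close> avoids quotients of power series over a polynomial ring.\<close>

definition "A = dq F0"
definition "B = dq' F0"
definition "P = dq A"
definition "Q = dq B"
definition "R = dq' B"
definition "X = dq F1"
definition "Y = dq' F1"
definition "Z = A * B"
definition "J = 1 + Q"

text \<open>This collects the terms containing the unknown series in the equations for
  \<open>F1\<close> and \<open>F2\<close>: \<open>theta F\<close> minus the two products in which a
  derivative of \<open>F\<close> meets a derivative of \<open>F0\<close>.\<close>

definition lie :: "real poly fps \<Rightarrow> real poly fps" where
  "lie F = (1 - B) * dq F + (1 - A) * dq' F"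

lemma lie_add: "lie (f + g) = lie f + lie g"
  and lie_diff: "lie (f - g) = lie f - lie g"
  and lie_1: "lie 1 = 0"
  and lie_numeral: "lie (numeral k) = 0"
  and lie_mult: "lie (f * g) = lie f * g + f * lie g"
  unfolding lie_def
  by (simp_all add: dq_add dq'_add dq_diff dq'_diff dq_1 dq'_1 dq_numeral dq'_numeral dq_mult dq'_mult
      algebra_simps)

lemma A_0: "fps_nth A 0 = 0" and A_1: "fps_nth A 1 = [:0, 1:]"
  by (simp_all add: A_def dq_def F0_0 F0_1[simplified] pderiv_pCons)

lemma B_0: "fps_nth B 0 = 0" and B_1: "fps_nth B 1 = 1"
  by (simp_all add: B_def dq'_def theta_nth dq_def F0_0 F0_1[simplified] pderiv_pCons one_pCons)

lemma dq'_A: "dq' A = Q"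
  by (simp add: A_def Q_def B_def dq_dq')

lemma dq'_P: "dq' P = dq Q"
  by (simp add: P_def dq'_A flip: dq_dq')

lemma dq'_Q: "dq' Q = dq R"
  by (simp add: Q_def R_def dq_dq')

text \<open>A tree has one more vertex than edges: trees rooted at a vertex of either colour, minus
  pairs of rooted trees joined by an edge.\<close>

lemma F0_conv: "F0 = A + B - A * B"
  using F0_eq by (simp add: A_def B_def theta_eq algebra_simps)

text \<open>The derivative of \<open>F0_conv\<close>. Solved for the second derivatives it says
  exactly \<open>lie A = A\<close>.\<close>

lemma A_conv: "A = P + Q - (P * B + A * Q)"
proof -
  have "A = dq (A + B - A * B)" by (subst F0_conv[symmetric]) (simp add: A_def)
  then show ?thesis by (simp add: dq_add dq_diff dq_mult P_def Q_def)
qed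

lemma B_conv: "B = Q + R - (Q * B + A * R)"
proof -
  have "B = dq' (A + B - A * B)" by (subst F0_conv[symmetric]) (simp add: B_def)
  then show ?thesis by (simp add: dq'_add dq'_diff dq'_mult dq'_A R_def)
qed

lemma lie_A: "lie A = A"
  using A_conv by (simp add: lie_def P_def[symmetric] dq'_A algebra_simps)

lemma lie_B: "lie B = B"
  using B_conv by (simp add: lie_def Q_def[symmetric] R_def[symmetric] algebra_simps)

text \<open>\<open>dq\<close> and \<open>lie\<close> commute up to the terms
  \<open>Q * dq F + P * dq' F\<close>. Differentiating \<open>lie A = A\<close> therefore produces
  quadratic terms in the second derivatives but nothing of third order; \<open>lie_Q\<close> and
  \<open>lie_R\<close> arise in the same way.\<close>

lemma lie_P: "lie P = P + 2 * P * Q"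
proof -
  have "P = dq (P + Q - (P * B + A * Q))" by (subst A_conv[symmetric]) (simp add: P_def)
  then have "P = dq P + dq Q - (dq P * B + P * Q + (P * Q + A * dq Q))"
    by (simp add: dq_add dq_diff dq_mult P_def[symmetric] Q_def[symmetric] algebra_simps)
  then show ?thesis unfolding lie_def dq'_P by (simp add: algebra_simps)
qed

lemma lie_Q: "lie Q = Q + Q * Q + P * R"
proof -
  have "Q = dq (Q + R - (Q * B + A * R))" by (subst B_conv[symmetric]) (simp add: Q_def)
  then have "Q = dq Q + dq R - (dq Q * B + Q * Q + (P * R + A * dq R))"
    by (simp add: dq_add dq_diff dq_mult P_def[symmetric] Q_def[symmetric] algebra_simps)
  then show ?thesis unfolding lie_def dq'_Q by (simp add: algebra_simps)
qed

lemma lie_R: "lie R = R + 2 * Q * R"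
proof -
  have "R = dq' (Q + R - (Q * B + A * R))" by (subst B_conv[symmetric]) (simp add: R_def)
  then have "R = dq R + dq' R - (dq R * B + Q * R + (Q * R + A * dq' R))"
    by (simp add: dq'_add dq'_diff dq'_mult dq'_A dq'_Q R_def[symmetric] algebra_simps)
  then show ?thesis unfolding lie_def by (simp add: algebra_simps)
qed

lemma const_0: "fps_nth P 0 = 0" "fps_nth Q 0 = 0" "fps_nth R 0 = 0" "fps_nth Z 0 = 0"
  by (simp_all add: P_def Q_def R_def Z_def dq_def dq'_def theta_nth A_0 B_0)

lemma vanishes_lie_step:
  assumes "vanishes n F" "c < n" "vanishes (Suc n) (lie F - of_nat c * F)"
  shows "vanishes (Suc n) F"
proof (rule vanishes_step[OF assms(1,2)])
  have "theta F - of_nat c * F = (lie F - of_nat c * F) + (B * dq F + A * dq' F)"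
    by (simp add: lie_def theta_eq algebra_simps)
  then show "vanishes (Suc n) (theta F - of_nat c * F)"
    using assms A_0 B_0 by (simp only: vanishes_add vanishes_mult vanishes_dq vanishes_dq')
qed

text \<open>
  The vector field \<open>lie\<close> multiplies the homogeneous component of degree \<open>n\<close> by \<open>n\<close> up to
  terms of higher degree, so the linear systems below have only the trivial solution.
\<close>

lemma lie_system_trivial:
  assumes "lie U - of_nat c * U = G1 * U + G2 * V" "lie V - of_nat c * V = H1 * U + H2 * V"
    and "fps_nth G1 0 = 0" "fps_nth G2 0 = 0" "fps_nth H1 0 = 0" "fps_nth H2 0 = 0"
    and "vanishes (Suc c) U" "vanishes (Suc c) V"
  shows "U = 0" "V = 0"
proof -
  have *: "vanishes (Suc c + n) U \<and> vanishes (Suc c + n) V" for n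
  proof (induction n)
    case 0
    then show ?case using assms(7,8) by simp
  next
    case (Suc n)
    have "vanishes (Suc (Suc c + n)) U"
      by (rule vanishes_lie_step[of _ _ c]) (use Suc assms in \<open>simp_all add: vanishes_add vanishes_mult\<close>)
    moreover have "vanishes (Suc (Suc c + n)) V"
      by (rule vanishes_lie_step[of _ _ c]) (use Suc assms in \<open>simp_all add: vanishes_add vanishes_mult\<close>)
    ultimately show ?case by simp
  qed
  have "vanishes n U \<and> vanishes n V" for n
    using *[of n] by (auto simp: vanishes_def)
  then show "U = 0" "V = 0" by (simp_all add: vanishes_all)
qed

lemma vanishes_2: "vanishes 2 F \<longleftrightarrow> fps_nth F 0 = 0 \<and> fps_nth F 1 = 0"
  by (auto simp: vanishes_def less_2_cases_iff)

text \<open>These are the relations among \<open>P\<close>, \<open>Q\<close>, \<open>R\<close> that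
  \<open>A_conv\<close> and \<open>B_conv\<close> do not provide by themselves. Modulo those two
  equations, the defects \<open>U\<close> and \<open>V\<close> satisfy a homogeneous linear system
  whose coefficients have no constant term.\<close>

lemma P_R_conv: "P - A - A * Q = 0" "R - B - B * Q = 0"
proof -
  define U where "U = P - A - A * Q"
  define V where "V = R - B - B * Q"
  have e2: "B - Q - R + Q * B + A * R = 0" using B_conv by (simp add: algebra_simps)
  have e1: "A - P - Q + P * B + A * Q = 0" using A_conv by (simp add: algebra_simps)
  \<comment> \<open>The right side is a multiple of \<open>e2\<close>, chosen so that what remains
    of \<open>lie U - U\<close> is linear in \<open>U\<close> and \<open>V\<close>.\<close>
  have "lie U - U - ((2 * Q - A * R) * U + (- A * (1 + Q)) * V) =
      - A * (1 + Q) * (B - Q - R + Q * B + A * R)"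
    unfolding U_def V_def lie_diff lie_mult lie_A lie_P lie_Q by (simp add: algebra_simps)
  then have LU: "lie U - of_nat 1 * U = (2 * Q - A * R) * U + (- A * (1 + Q)) * V"
    using e2 by simp
  have "lie V - V - ((- B * (1 + Q)) * U + (2 * Q - B * P) * V) =
      - B * (1 + Q) * (A - P - Q + P * B + A * Q)"
    unfolding U_def V_def lie_diff lie_mult lie_B lie_R lie_Q by (simp add: algebra_simps)
  then have LV: "lie V - of_nat 1 * V = (- B * (1 + Q)) * U + (2 * Q - B * P) * V"
    using e1 by simp
  \<comment> \<open>The operator \<open>lie - 1\<close> says nothing about degree 1, so the
    coefficients up to that degree are compared directly.\<close>
  have "vanishes (Suc 1) U" "vanishes (Suc 1) V"
    unfolding Suc_1 vanishes_2 U_def V_def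
    using A_0 B_0 A_1 B_1 const_0
    by (simp_all add: fps_mult_nth P_def R_def dq_def dq'_def theta_nth pderiv_pCons one_pCons)
  note lie_system_trivial[OF LU LV _ _ _ _ this]
  then have "U = 0" "V = 0" using A_0 B_0 const_0 by (simp_all add: fps_numeral_nth)
  then show "P - A - A * Q = 0" "R - B - B * Q = 0" by (simp_all add: U_def V_def)
qed

lemma P_eq: "P = A * J" and R_eq: "R = B * J"
  using P_R_conv by (simp_all add: J_def algebra_simps)

text \<open>Inserting P = A (1 + Q) into \<open>A_conv\<close> leaves Q - A B Q = A B.\<close>

lemma J_eq: "J = 1 + Z * J"
proof -
  have "A * B = Q - Q * (A * B) + (P - A - A * Q) * (1 - B) - (P + Q - (P * B + A * Q) - A)"
    by (simp add: algebra_simps)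
  also have "\<dots> = Q - Q * (A * B)" using A_conv P_R_conv by simp
  finally show ?thesis by (simp add: J_def Z_def algebra_simps)
qed

lemma Q_eq: "Q = Z * J"
  using J_eq by (simp add: J_def)

lemma J_mult: "(1 - Z) * J = 1"
  using J_eq by (simp add: algebra_simps)

lemma dq_Z: "dq Z = Z * J * (1 + A)"
proof -
  have "dq Z = P * B + A * Q" by (simp add: Z_def dq_mult P_def Q_def)
  then show ?thesis by (simp add: P_eq Q_eq) (simp add: Z_def algebra_simps)
qed

lemma dq'_Z: "dq' Z = Z * J * (1 + B)"
proof -
  have "dq' Z = Q * B + A * R" by (simp add: Z_def dq'_mult dq'_A R_def)
  then show ?thesis by (simp add: R_eq Q_eq) (simp add: Z_def algebra_simps)
qed

lemma dq_J: "dq J = J * J * dq Z"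
proof -
  have "dq J = dq (1 + Z * J)" using J_eq by simp
  then have "(1 - Z) * dq J = dq Z * J" by (simp add: dq_add dq_mult dq_1 algebra_simps)
  then have "J * ((1 - Z) * dq J) = J * J * dq Z" by (simp only: mult_ac)
  moreover have "J * ((1 - Z) * dq J) = ((1 - Z) * J) * dq J" by (simp only: mult_ac)
  ultimately show ?thesis by (simp add: J_mult)
qed

lemma dq'_J: "dq' J = J * J * dq' Z"
proof -
  have "dq' J = dq' (1 + Z * J)" using J_eq by simp
  then have "(1 - Z) * dq' J = dq' Z * J" by (simp add: dq'_add dq'_mult dq'_1 algebra_simps)
  then have "J * ((1 - Z) * dq' J) = J * J * dq' Z" by (simp only: mult_ac)
  moreover have "J * ((1 - Z) * dq' J) = ((1 - Z) * J) * dq' J" by (simp only: mult_ac)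
  ultimately show ?thesis by (simp add: J_mult)
qed

lemma lie_Z: "lie Z = 2 * Z"
  by (simp add: Z_def lie_mult lie_A lie_B)

lemma lie_J: "lie J = 2 * Z * J * J"
proof -
  have "lie J = Q + Q * Q + P * R" by (simp add: J_def lie_add lie_1 lie_Q)
  also have "\<dots> = Q * J + P * R" by (simp add: J_def algebra_simps)
  also have "\<dots> = 2 * Z * J * J" unfolding P_eq R_eq Q_eq by (simp add: Z_def algebra_simps)
  finally show ?thesis .
qed

text \<open>The left side is \<open>lie F1\<close>. By \<open>F0_conv\<close> the tree terms of
  \<open>F1_eq\<close> collapse to \<open>Q - Z\<close>.\<close>

lemma lie_F1: "(1 - B) * X + (1 - A) * Y = Q - Z"
proof -
  have "X + Y = Q - (A + B) + F0 + A * Y + X * B"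
    using F1_eq by (simp add: X_def Y_def Q_def B_def A_def theta_eq)
  then have "X + Y = Q - (A + B) + (A + B - A * B) + A * Y + X * B" by (simp only: F0_conv[symmetric])
  then show ?thesis by (simp add: Z_def algebra_simps)
qed

lemma dq_Y: "dq Y = dq' X"
  by (simp add: X_def Y_def dq_dq')

text \<open>\<open>lie_F1\<close> is a single equation for the two unknowns \<open>X\<close> and
  \<open>Y\<close>. Its two derivatives form a closed linear system for them, again with the
  commutator terms of \<open>lie\<close> and \<open>dq\<close> or \<open>dq'\<close>.\<close>

lemma lie_X: "lie X = Q * X + P * Y + dq Q - dq Z"
proof -
  have "dq ((1 - B) * X + (1 - A) * Y) = dq (Q - Z)" by (simp only: lie_F1)
  then show ?thesis
    by (simp add: dq_add dq_diff dq_mult dq_1 P_def[symmetric] Q_def[symmetric] lie_def dq_Y algebra_simps)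
qed

lemma lie_Y: "lie Y = R * X + Q * Y + dq' Q - dq' Z"
proof -
  have "dq' ((1 - B) * X + (1 - A) * Y) = dq' (Q - Z)" by (simp only: lie_F1)
  then show ?thesis
    by (simp add: dq'_add dq'_diff dq'_mult dq'_1 dq'_A R_def[symmetric] lie_def dq_Y algebra_simps)
qed

lemma dq_Q: "dq Q = J * J * dq Z" and dq'_Q': "dq' Q = J * J * dq' Z"
  using dq_J dq'_J by (simp_all add: J_def dq_add dq'_add dq_1 dq'_1)

text \<open>The guess comes from the structure of unicyclic graphs: rooted trees attached to a cycle
  of length 2l with l \<ge> 2, which has 2l symmetries. This gives F_1 = sum of Z^l/(2l) = (- log (1
  - Z) - Z)/2, whose derivatives are the stated ones. Verifying the derivatives directly avoids the
  logarithm.\<close>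

lemma X_eq: "2 * X = J * J * Z * Z * (1 + A)" and Y_eq: "2 * Y = J * J * Z * Z * (1 + B)"
proof -
  define M where "M = 2 * X - J * J * Z * Z * (1 + A)"
  define N where "N = 2 * Y - J * J * Z * Z * (1 + B)"
  have ZJ: "Z * J = J - 1" unfolding Q_eq[symmetric] by (simp add: J_def)
  \<comment> \<open>The inhomogeneous terms of \<open>lie_X\<close> and \<open>lie_Y\<close> contain
    \<open>J * J - 1\<close>. Together with the factor \<open>Z * J\<close> of \<open>dq Z\<close>
    and \<open>dq' Z\<close>, this rewriting exposes the common factor
    \<open>J * J * Z * Z\<close>.\<close>
  have JJ: "J * J - 1 = (J + 1) * (Z * J)" unfolding ZJ by (simp add: algebra_simps)
  \<comment> \<open>This is what remains after the common factor, with \<open>W\<close> for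
    \<open>Z * J\<close> and \<open>C\<close> for \<open>A\<close> or \<open>B\<close>.\<close>
  have bracket: "W * (1 + C) + (C * J + W) + 2 * (J + 1) * (1 + C) - 4 * W * (1 + C) - 4 * (1 + C) - C = 0"
    if "W = J - 1" for W C
    unfolding that by (simp add: algebra_simps)
  have "lie M - (Q * M + P * N) =
     J * J * Z * Z * (Q * (1 + A) + P * (1 + B)) + 2 * (J * J - 1) * dq Z
       - 4 * J * J * J * Z * Z * Z * (1 + A) - 4 * J * J * Z * Z * (1 + A) - J * J * Z * Z * A"
    unfolding M_def N_def lie_diff lie_mult lie_add lie_numeral lie_1 lie_X lie_A lie_Z lie_J dq_Q
    by (simp add: algebra_simps)
  also have "P * (1 + B) = A * J + Z * J" by (simp add: P_eq Z_def algebra_simps)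
  also have "J * J * Z * Z * (Q * (1 + A) + (A * J + Z * J)) + 2 * (J * J - 1) * dq Z
       - 4 * J * J * J * Z * Z * Z * (1 + A) - 4 * J * J * Z * Z * (1 + A) - J * J * Z * Z * A =
     J * J * Z * Z * (Z * J * (1 + A) + (A * J + Z * J) + 2 * (J + 1) * (1 + A)
       - 4 * (Z * J) * (1 + A) - 4 * (1 + A) - A)"
    unfolding JJ Q_eq dq_Z by (simp add: algebra_simps)
  also have "\<dots> = 0" unfolding bracket[OF ZJ] by simp
  finally have LM: "lie M - of_nat 0 * M = Q * M + P * N" by simp
  have "lie N - (R * M + Q * N) =
     J * J * Z * Z * (Q * (1 + B) + R * (1 + A)) + 2 * (J * J - 1) * dq' Z
       - 4 * J * J * J * Z * Z * Z * (1 + B) - 4 * J * J * Z * Z * (1 + B) - J * J * Z * Z * B"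
    unfolding M_def N_def lie_diff lie_mult lie_add lie_numeral lie_1 lie_Y lie_B lie_Z lie_J dq'_Q'
    by (simp add: algebra_simps)
  also have "R * (1 + A) = B * J + Z * J" by (simp add: R_eq Z_def algebra_simps)
  also have "J * J * Z * Z * (Q * (1 + B) + (B * J + Z * J)) + 2 * (J * J - 1) * dq' Z
       - 4 * J * J * J * Z * Z * Z * (1 + B) - 4 * J * J * Z * Z * (1 + B) - J * J * Z * Z * B =
     J * J * Z * Z * (Z * J * (1 + B) + (B * J + Z * J) + 2 * (J + 1) * (1 + B)
       - 4 * (Z * J) * (1 + B) - 4 * (1 + B) - B)"
    unfolding JJ Q_eq dq'_Z by (simp add: algebra_simps)
  also have "\<dots> = 0" unfolding bracket[OF ZJ] by simp
  finally have LN: "lie N - of_nat 0 * N = R * M + Q * N" by simp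
  have "vanishes (Suc 0) M" "vanishes (Suc 0) N"
    using const_0 by (simp_all add: vanishes_def M_def N_def X_def Y_def dq_def dq'_def theta_nth F1_0)
  note lie_system_trivial[OF LM LN _ _ _ _ this]
  then have "M = 0" "N = 0" using const_0 by simp_all
  then show "2 * X = J * J * Z * Z * (1 + A)" "2 * Y = J * J * Z * Z * (1 + B)"
    by (simp_all add: M_def N_def)
qed

text \<open>On the right of the equation for \<open>F2\<close> only \<open>X\<close>,
  \<open>Y\<close> and the mixed derivative \<open>dq Y\<close> are left, all known from
  \<open>X_eq\<close> and \<open>Y_eq\<close>. The factor 4 clears the two halves in the product of
  \<open>X\<close> and \<open>Y\<close>.\<close>

lemma lie_F2:
  "4 * (lie F2 + F2) = J * J * J * J * Z * Z * (4 + Z * Z) * ((1 + A) * (1 + B))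
     + 2 * (J * J * J * Z * Z * Z) - 2 * (J * J * Z * Z) * (2 + A + B)"
proof -
  have "theta F2 + F2 = dq Y - (X + Y) + A * dq' F2 + X * Y + dq F2 * B"
    using F2_eq by (simp add: X_def Y_def A_def B_def theta_eq)
  then have "lie F2 + F2 = dq Y - (X + Y) + X * Y"
    by (simp add: lie_def theta_eq algebra_simps)
  then have "4 * (lie F2 + F2) = 4 * (dq Y - (X + Y) + X * Y)"
    by (simp only:)
  also have "\<dots> = 2 * (2 * dq Y) - 2 * (2 * X + 2 * Y) + (2 * X) * (2 * Y)"
    by (simp add: algebra_simps)
  finally have "4 * (lie F2 + F2) = 2 * (2 * dq Y) - 2 * (2 * X + 2 * Y) + (2 * X) * (2 * Y)" .
  moreover have "2 * dq Y = 2 * (J * J * J * J * Z * Z * ((1 + A) * (1 + B))) + J * J * J * Z * Z * Z"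
  proof -
    have "2 * dq Y = dq (2 * Y)" by (simp add: dq_mult dq_numeral)
    also have "\<dots> = 2 * J * (J * J * (Z * J * (1 + A))) * Z * Z * (1 + B)
        + 2 * J * J * Z * (Z * J * (1 + A)) * (1 + B) + J * J * Z * Z * (Z * J)"
      unfolding Y_eq dq_mult dq_J dq_Z dq_add dq_1 Q_def[symmetric] Q_eq by (simp add: algebra_simps)
    also have "\<dots> = 2 * J * J * J * Z * Z * (1 + A) * (1 + B) * (1 + Z * J) + J * J * J * Z * Z * Z"
      by (simp add: algebra_simps)
    also have "\<dots> = 2 * (J * J * J * J * Z * Z * ((1 + A) * (1 + B))) + J * J * J * Z * Z * Z"
      unfolding J_eq[symmetric] by (simp add: algebra_simps)
    finally show ?thesis .
  qed
  ultimately show ?thesis unfolding X_eq Y_eq by (simp add: algebra_simps)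
qed

end

section \<open>Restriction to the diagonal x = y, that is q = 1\<close>

definition diag :: "real poly fps \<Rightarrow> real fps" where
  "diag F = Abs_fps (\<lambda>n. poly (fps_nth F n) 1)"

lemma diag_add: "diag (f + g) = diag f + diag g"
  and diag_diff: "diag (f - g) = diag f - diag g"
  and diag_1: "diag 1 = 1"
  and diag_numeral: "diag (numeral k) = numeral k"
  and diag_mult: "diag (f * g) = diag f * diag g"
  and diag_theta: "diag (theta f) = theta (diag f)"
  by (auto simp: diag_def fps_eq_iff fps_mult_nth poly_sum fps_numeral_nth theta_nth)

context bicolored_series
begin

lemma theta_diag_A: "theta (diag A) = diag A * (1 + diag B) * diag J"
proof -
  have "theta A = A * J + Z * J" by (simp add: theta_eq dq'_A P_def[symmetric] P_eq Q_eq)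
  then have "theta A = A * (1 + B) * J" by (simp add: Z_def algebra_simps)
  then show ?thesis by (simp add: diag_theta[symmetric] diag_add diag_mult diag_1)
qed

lemma theta_diag_B: "theta (diag B) = diag B * (1 + diag A) * diag J"
proof -
  have "theta B = Z * J + B * J" by (simp add: theta_eq Q_def[symmetric] R_def[symmetric] R_eq Q_eq)
  then have "theta B = B * (1 + A) * J" by (simp add: Z_def algebra_simps)
  then show ?thesis by (simp add: diag_theta[symmetric] diag_add diag_mult diag_1)
qed

text \<open>The symmetry of the colours is obtained from uniqueness: the difference \<open>d\<close>
  satisfies \<open>theta d = d * diag J\<close>, and \<open>diag J\<close> has constant term 1, so
  \<open>d\<close> is determined by its coefficients up to degree 1, which are zero.\<close>

lemma diag_A_eq_diag_B: "diag A = diag B"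
proof -
  define d where "d = diag A - diag B"
  have j: "fps_nth (diag J - 1) 0 = 0" by (simp add: diag_def J_def const_0)
  have "theta d = d * diag J"
    by (simp add: d_def theta_diff theta_diag_A theta_diag_B algebra_simps)
  then have eq: "theta d - of_nat 1 * d = (diag J - 1) * d" by (simp add: algebra_simps)
  have *: "vanishes (2 + n) d" for n
  proof (induction n)
    case 0
    show ?case using A_0 B_0 A_1 B_1
      by (simp add: vanishes_def less_2_cases_iff d_def diag_def)
  next
    case (Suc n)
    have "vanishes (Suc (2 + n)) d"
    proof (rule vanishes_step[OF Suc])
      show "vanishes (Suc (2 + n)) (theta d - of_nat 1 * d)"
        unfolding eq using j Suc by (rule vanishes_mult)
    qed simp
    then show ?case by simp
  qed
  have "vanishes n d" for n using *[of n] by (simp add: vanishes_def)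
  then show ?thesis by (metis vanishes_all d_def eq_iff_diff_eq_0)
qed

lemma diag_J: "(1 - diag A * diag A) * diag J = 1"
  using arg_cong[OF J_mult, of diag] by (simp add: diag_mult diag_diff diag_1 Z_def diag_A_eq_diag_B)

lemma theta_diag_A': "(1 - diag A) * theta (diag A) = diag A"
proof -
  have "(1 - diag A) * theta (diag A) = diag A * ((1 - diag A * diag A) * diag J)"
    unfolding theta_diag_A diag_A_eq_diag_B[symmetric] by (simp add: algebra_simps)
  then show ?thesis by (simp add: diag_J)
qed

lemma diag_A_nth: "fps_nth (diag A) 0 = 0" "fps_nth (diag A) 1 = 1"
  using A_0 A_1 by (simp_all add: diag_def)

lemma diag_F2:
  defines "T \<equiv> diag A" and "I \<equiv> diag J"
  shows "4 * ((1 - T) * theta (diag F2) + diag F2) =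
    I ^ 4 * T ^ 4 * (4 + T ^ 4) * (1 + T)\<^sup>2 + 2 * (I ^ 3 * T ^ 6) - 4 * (I\<^sup>2 * T ^ 4) * (1 + T)"
proof -
  have L: "(1 - T) * theta (diag F2) = diag (lie F2)"
    unfolding lie_def theta_eq diag_theta[symmetric]
    by (simp add: diag_mult diag_diff diag_add diag_1 diag_A_eq_diag_B[symmetric] T_def algebra_simps)
  have Z: "diag Z = T * T" by (simp add: Z_def diag_mult diag_A_eq_diag_B T_def)
  have "4 * (diag (lie F2) + diag F2) =
      I * I * I * I * diag Z * diag Z * (4 + diag Z * diag Z) * ((1 + T) * (1 + T))
       + 2 * (I * I * I * diag Z * diag Z * diag Z) - 2 * (I * I * diag Z * diag Z) * (2 + T + T)"
    using arg_cong[OF lie_F2, of diag]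
    by (simp only: diag_mult diag_diff diag_add diag_1 diag_numeral diag_A_eq_diag_B[symmetric] T_def I_def)
  also have "\<dots> = I ^ 4 * T ^ 4 * (4 + T ^ 4) * (1 + T)\<^sup>2 + 2 * (I ^ 3 * T ^ 6)
      - 4 * (I\<^sup>2 * T ^ 4) * (1 + T)"
    unfolding Z by (simp add: algebra_simps power4_eq_xxxx power2_eq_square eval_nat_numeral)
  finally show ?thesis unfolding L .
qed

end

interpretation N_series: bicolored_series tree_egf unicyclic_egf bicyclic_egf
proof
  show "fps_nth tree_egf 0 = 0" "fps_nth unicyclic_egf 0 = 0"
    by (simp_all add: tree_egf_def unicyclic_egf_def bgf_def N_egf_def N_bi_degenerate)
  show "fps_nth tree_egf 1 = [:1, 1:]"
    by (simp add: tree_egf_def bgf_def N_egf_def N_bi_degenerate monom_altdef one_pCons)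
qed (fact tree_egf_eq unicyclic_egf_eq bicyclic_egf_eq)+

lemma diag_bicyclic_egf_nth: "fps_nth (diag bicyclic_egf) n = real (N_bi_total n 2) / fact n"
proof -
  have "fps_nth (diag bicyclic_egf) n = (\<Sum>r\<le>n. N_egf 2 r (n - r))"
    by (simp add: diag_def bicyclic_egf_def bgf_def poly_sum poly_monom)
  also have "\<dots> = (\<Sum>r\<le>n. real (n choose r) * real (N_bi r (n - r) 2) / fact n)"
    by (intro sum.cong refl) (simp add: N_egf_def binomial_fact)
  finally show ?thesis by (simp add: N_bi_total_def sum_divide_distrib)
qed

section \<open>Coefficient asymptotics\<close>

definition geom :: "real fps" where "geom = Abs_fps (\<lambda>_. 1)"

lemma geom_nth: "fps_nth geom n = 1"
  by (simp add: geom_def)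

lemma geom_mult: "(1 - fps_X) * geom = 1"
  by (rule fps_ext) (simp add: geom_def algebra_simps)

lemma mult_geom_nth: "fps_nth (h * geom) n = (\<Sum>i=0..n. fps_nth h i)"
  by (simp add: fps_mult_nth geom_def)

lemma geom2_nth: "fps_nth (geom ^ 2) n = real n + 1"
  unfolding power2_eq_square mult_geom_nth by (simp add: geom_def)

lemma geom3_nth: "fps_nth (geom ^ 3) n = (real n + 1) * (real n + 2) / 2"
proof -
  have "geom ^ 3 = geom ^ 2 * geom" by (simp add: eval_nat_numeral mult_ac)
  moreover have "(\<Sum>i=0..n. real i + 1) = (real n + 1) * (real n + 2) / 2"
    by (induction n) (simp_all add: field_simps)
  ultimately show ?thesis by (simp only: mult_geom_nth geom2_nth)
qed

lemma geom4_nth: "fps_nth (geom ^ 4) n = (real n + 1) * (real n + 2) * (real n + 3) / 6"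
proof -
  have "geom ^ 4 = geom ^ 3 * geom" by (simp add: eval_nat_numeral mult_ac)
  moreover have "(\<Sum>i=0..n. (real i + 1) * (real i + 2) / 2) = (real n + 1) * (real n + 2) * (real n + 3) / 6"
    by (induction n) (simp_all add: field_simps)
  ultimately show ?thesis by (simp only: mult_geom_nth geom3_nth)
qed

text \<open>Coefficientwise domination replaces O-estimates: it is stable under sums, under products
  and, by \<open>compose_T_majorized\<close>, under substitution of the tree series.\<close>

definition majorized :: "real fps \<Rightarrow> real fps \<Rightarrow> bool" (infix "\<preceq>" 50) where
  "f \<preceq> h \<longleftrightarrow> (\<forall>n. \<bar>fps_nth f n\<bar> \<le> fps_nth h n)"

lemma majorized_add: "f \<preceq> h \<Longrightarrow> f' \<preceq> h' \<Longrightarrow> f + f' \<preceq> h + h'"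
  unfolding majorized_def by (auto intro: order_trans[OF abs_triangle_ineq add_mono])

lemma majorized_diff: "f \<preceq> h \<Longrightarrow> f' \<preceq> h' \<Longrightarrow> f - f' \<preceq> h + h'"
  unfolding majorized_def by (auto intro: order_trans[OF abs_triangle_ineq4 add_mono])

lemma majorized_mult: "f \<preceq> h \<Longrightarrow> f' \<preceq> h' \<Longrightarrow> f * f' \<preceq> h * h'"
  unfolding majorized_def fps_mult_nth
proof (intro allI)
  fix n assume *: "\<forall>n. \<bar>fps_nth f n\<bar> \<le> fps_nth h n" "\<forall>n. \<bar>fps_nth f' n\<bar> \<le> fps_nth h' n"
  have "\<bar>\<Sum>i=0..n. fps_nth f i * fps_nth f' (n - i)\<bar> \<le> (\<Sum>i=0..n. \<bar>fps_nth f i * fps_nth f' (n - i)\<bar>)"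
    by (rule sum_abs)
  also have "\<dots> \<le> (\<Sum>i=0..n. fps_nth h i * fps_nth h' (n - i))"
    unfolding abs_mult using * by (intro sum_mono mult_mono) (auto intro: order_trans[OF abs_ge_zero])
  finally show "\<bar>\<Sum>i=0..n. fps_nth f i * fps_nth f' (n - i)\<bar> \<le> (\<Sum>i=0..n. fps_nth h i * fps_nth h' (n - i))" .
qed

lemma majorized_numeral: "f \<preceq> h \<Longrightarrow> numeral k * f \<preceq> numeral k * h"
  by (simp add: majorized_def fps_numeral_fps_const abs_mult)

lemma majorized_X_power: "f \<preceq> geom \<Longrightarrow> f * fps_X ^ k \<preceq> geom"
  by (auto simp: majorized_def geom_def fps_X_power_mult_right_nth)

text \<open>The series 1/(1 - t^2). Substituting the tree series for t gives
  \<open>diag J\<close>.\<close>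

definition geom_even :: "real fps" where "geom_even = Abs_fps (\<lambda>n. if even n then 1 else 0)"

lemma geom_even_mult: "(1 - fps_X\<^sup>2) * geom_even = 1"
  by (rule fps_ext) (auto simp: geom_even_def algebra_simps fps_X_power_mult_nth)

lemma one_plus_X_geom_even: "(1 + fps_X) * geom_even = geom"
proof (rule fps_ext)
  fix n show "fps_nth ((1 + fps_X) * geom_even) n = fps_nth geom n"
    by (cases n) (simp_all add: geom_even_def geom_def algebra_simps)
qed

lemma majorized_geom: "geom \<preceq> geom" "geom_even \<preceq> geom"
  by (simp_all add: majorized_def geom_def geom_even_def)

text \<open>The right side of \<open>diag_F2\<close> divided by 4, as a series in t =
  \<open>diag A\<close>.\<close>

definition source :: "real fps" where
  "source = fps_const (1 / 4) * (geom_even ^ 4 * fps_X ^ 4 * (4 + fps_X ^ 4) * (1 + fps_X)\<^sup>2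
     + 2 * (geom_even ^ 3 * fps_X ^ 6) - 4 * (geom_even\<^sup>2 * fps_X ^ 4) * (1 + fps_X))"

text \<open>Only the first summand of \<open>source\<close> has a pole of order 4 at t = 1, with
  leading coefficient (1/4) * 5 * 4/16 = 5/16. Subtracting it makes the numerator vanish at t = 1,
  so a factor 1 - t cancels.\<close>

lemma source_majorized: "16 * source - 5 * geom ^ 4 \<preceq> 100 * geom ^ 3"
proof -
  let ?G = geom and ?E = geom_even and ?X = "fps_X :: real fps"
  \<comment> \<open>The quotient of 5 (1+t)^2 - 16 t^4 - 4 t^8 by 1 - t.\<close>
  let ?r = "5 + 15 * ?X + 20 * ?X ^ 2 + 20 * ?X ^ 3 + 4 * ?X ^ 4 + 4 * ?X ^ 5 + 4 * ?X ^ 6 + 4 * ?X ^ 7"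
  have c: "16 * source = 4 * (?E ^ 4 * ?X ^ 4 * (4 + ?X ^ 4) * (1 + ?X)\<^sup>2
     + 2 * (?E ^ 3 * ?X ^ 6) - 4 * (?E\<^sup>2 * ?X ^ 4) * (1 + ?X))"
    by (simp add: source_def fps_numeral_fps_const mult.assoc[symmetric])
  have G: "?G = (1 + ?X) * ?E" by (simp add: one_plus_X_geom_even)
  have "4 * (?E ^ 4 * ?X ^ 4 * (4 + ?X ^ 4) * (1 + ?X)\<^sup>2) - 5 * ?G ^ 4 =
      ?E ^ 4 * (1 + ?X)\<^sup>2 * (16 * ?X ^ 4 + 4 * ?X ^ 8 - 5 * (1 + ?X)\<^sup>2)"
    unfolding G by (simp add: power_mult_distrib algebra_simps eval_nat_numeral)
  also have "16 * ?X ^ 4 + 4 * ?X ^ 8 - 5 * (1 + ?X)\<^sup>2 = - ((1 - ?X) * ?r)"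
    by (simp add: algebra_simps eval_nat_numeral)
  also have "?E ^ 4 * (1 + ?X)\<^sup>2 * - ((1 - ?X) * ?r) = - (((1 - ?X) * ((1 + ?X) * ?E)) * ((1 + ?X) * ?E) * ?E\<^sup>2 * ?r)"
    by (simp add: algebra_simps eval_nat_numeral)
  also have "\<dots> = - (?G * ?E\<^sup>2 * ?r)"
    unfolding one_plus_X_geom_even geom_mult by simp
  finally have 1: "4 * (?E ^ 4 * ?X ^ 4 * (4 + ?X ^ 4) * (1 + ?X)\<^sup>2) - 5 * ?G ^ 4 = - (?G * ?E\<^sup>2 * ?r)" .
  have 2: "(?E\<^sup>2 * ?X ^ 4) * (1 + ?X) = ?E * ((1 + ?X) * ?E) * ?X ^ 4"
    by (simp add: algebra_simps power2_eq_square)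
  \<comment> \<open>Each summand is arranged as a product of three factors that are each dominated
    by \<open>geom\<close>, the factor 1 filling up where only two are present. The bound 100 is the
    sum of the absolute values of the numerical coefficients.\<close>
  have eq: "16 * source - 5 * geom ^ 4 = 8 * (?E * ?E * (?E * ?X ^ 6)) - 16 * (1 * (?E * (?G * ?X ^ 4)))
     - (5 * (?E * ?E * (?G * ?X ^ 0)) + 15 * (?E * ?E * (?G * ?X ^ 1)) + 20 * (?E * ?E * (?G * ?X ^ 2))
      + 20 * (?E * ?E * (?G * ?X ^ 3)) + 4 * (?E * ?E * (?G * ?X ^ 4)) + 4 * (?E * ?E * (?G * ?X ^ 5))
      + 4 * (?E * ?E * (?G * ?X ^ 6)) + 4 * (?E * ?E * (?G * ?X ^ 7)))"
  proof -
    have "16 * source - 5 * geom ^ 4 = (4 * (?E ^ 4 * ?X ^ 4 * (4 + ?X ^ 4) * (1 + ?X)\<^sup>2) - 5 * ?G ^ 4)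
        + 8 * (?E ^ 3 * ?X ^ 6) - 16 * ((?E\<^sup>2 * ?X ^ 4) * (1 + ?X))"
      unfolding c by (simp add: algebra_simps)
    then show ?thesis unfolding 1 2 one_plus_X_geom_even
      by (simp add: algebra_simps power2_eq_square power3_eq_cube)
  qed
  have one: "1 \<preceq> geom" by (simp add: majorized_def geom_def)
  have "16 * source - 5 * geom ^ 4 \<preceq> 8 * (?G * ?G * ?G) + 16 * (?G * (?G * ?G)) +
     (5 * (?G * ?G * ?G) + 15 * (?G * ?G * ?G) + 20 * (?G * ?G * ?G) + 20 * (?G * ?G * ?G) +
      4 * (?G * ?G * ?G) + 4 * (?G * ?G * ?G) + 4 * (?G * ?G * ?G) + 4 * (?G * ?G * ?G))"
    unfolding eq
    by (intro majorized_add majorized_diff majorized_numeral majorized_mult majorized_X_power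
        majorized_geom one)
  also have "\<dots> = 100 * geom ^ 3" by (simp add: power3_eq_cube algebra_simps)
  finally show ?thesis .
qed

text \<open>The solution g of \<open>theta g + g = source\<close>.\<close>

definition source_int :: "real fps" where
  "source_int = Abs_fps (\<lambda>m. fps_nth source m / (real m + 1))"

lemma source_int_majorized: "source_int - fps_const (5 / 48) * geom ^ 3 \<preceq> fps_const 8 * geom ^ 2"
  unfolding majorized_def
proof
  fix m
  let ?s = "fps_nth source m" and ?x = "real m + 1"
  have "\<bar>16 * ?s - 5 * (?x * (?x + 1) * (?x + 2) / 6)\<bar> \<le> 50 * (?x * (?x + 1))"
    using source_majorized[unfolded majorized_def, rule_format, of m]
    by (simp add: geom4_nth geom3_nth fps_numeral_fps_const algebra_simps)
  then have "\<bar>?s - 5 / 48 * (?x * (?x * (?x + 1) / 2))\<bar> \<le> ?x * (8 * ?x)"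
  proof -
    assume a: "\<bar>16 * ?s - 5 * (?x * (?x + 1) * (?x + 2) / 6)\<bar> \<le> 50 * (?x * (?x + 1))"
    \<comment> \<open>Dividing by \<open>?x\<close> turns the cubic
      \<open>?x * (?x + 1) * (?x + 2)\<close> into a quadratic whose factors are one step off those
      in \<open>geom ^ 3\<close>; this shift costs the term with 5/3. Then (50 + 5/3) * 2 \<le> 16 *
      8 gives the constant 8.\<close>
    have "16 * (?s - 5 / 48 * (?x * (?x * (?x + 1) / 2))) =
        (16 * ?s - 5 * (?x * (?x + 1) * (?x + 2) / 6)) + 5 / 3 * (?x * (?x + 1))"
      by (simp add: field_simps)
    moreover have "?x * (?x + 1) \<le> 2 * (?x * ?x)" "0 \<le> ?x * (?x + 1)"
      by (simp_all add: algebra_simps)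
    moreover have "\<bar>w\<bar> \<le> 8 * v" if "16 * w = b + 5 / 3 * u" "\<bar>b\<bar> \<le> 50 * u" "u \<le> 2 * v" "0 \<le> u"
      for w b u v :: real
      using that by linarith
    ultimately have "\<bar>?s - 5 / 48 * (?x * (?x * (?x + 1) / 2))\<bar> \<le> 8 * (?x * ?x)" using a by blast
    then show ?thesis by (simp only: mult_ac)
  qed
  then have "\<bar>?s - 5 / 48 * (?x * (?x * (?x + 1) / 2))\<bar> / ?x \<le> ?x * (8 * ?x) / ?x"
    by (intro divide_right_mono) simp_all
  moreover have "fps_nth (source_int - fps_const (5 / 48) * geom ^ 3) m =
      (?s - 5 / 48 * (?x * (?x * (?x + 1) / 2))) / ?x"
    by (simp add: source_int_def geom3_nth field_simps)
  ultimately show "\<bar>fps_nth (source_int - fps_const (5 / 48) * geom ^ 3) m\<bar> \<le> fps_nth (fps_const 8 * geom ^ 2) m"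
    by (simp add: geom2_nth abs_divide)
qed

section \<open>Powers of the tree series and substitution into it\<close>

locale tree_series =
  fixes T :: "real fps"
  assumes T_0: "fps_nth T 0 = 0" and T_1: "fps_nth T 1 = 1" and T_eq: "(1 - T) * theta T = T"
begin

lemma theta_T_power: "(1 - T) * theta (T ^ m) = of_nat m * T ^ m"
proof (induction m)
  case 0
  then show ?case by (simp add: theta_1)
next
  case (Suc m)
  have "(1 - T) * theta (T ^ Suc m) = ((1 - T) * theta T) * T ^ m + T * ((1 - T) * theta (T ^ m))"
    by (simp add: theta_mult algebra_simps)
  then show ?case unfolding T_eq Suc by (simp add: algebra_simps)
qed

lemma one_minus_T: "1 - T \<noteq> 0"
proof
  assume "1 - T = 0"
  then have "fps_nth (1 - T) 0 = 0" by simp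
  then show False by (simp add: T_0)
qed

text \<open>As theta (T^m) = m T^m/(1-T), the combination (m+1) theta (T^m) - m theta (T^(m+1))
  equals m (m+1) T^m without any denominator. Comparing coefficients gives a two-term recurrence in
  \<open>m\<close>.\<close>

lemma T_power_step:
  "real m * real n * fps_nth (T ^ Suc m) n = real (Suc m) * (real n - real m) * fps_nth (T ^ m) n"
proof -
  have "(1 - T) * (of_nat (Suc m) * theta (T ^ m) - of_nat m * theta (T ^ Suc m)) =
      of_nat (Suc m) * ((1 - T) * theta (T ^ m)) - of_nat m * ((1 - T) * theta (T ^ Suc m))"
    by (simp only: algebra_simps)
  also have "\<dots> = (1 - T) * (of_nat (Suc m) * of_nat m * T ^ m)"
    unfolding theta_T_power by (simp add: algebra_simps)
  finally have "of_nat (Suc m) * theta (T ^ m) - of_nat m * theta (T ^ Suc m) = of_nat (Suc m) * of_nat m * T ^ m"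
    using mult_left_cancel[OF one_minus_T] by blast
  then have "fps_const (real (Suc m)) * theta (T ^ m) - fps_const (real m) * theta (T ^ Suc m) =
      fps_const (real (Suc m)) * (fps_const (real m) * T ^ m)"
    by (simp only: fps_of_nat mult.assoc)
  then have "fps_nth (fps_const (real (Suc m)) * theta (T ^ m) - fps_const (real m) * theta (T ^ Suc m)) n =
      fps_nth (fps_const (real (Suc m)) * (fps_const (real m) * T ^ m)) n" by (rule arg_cong)
  then show ?thesis
    unfolding fps_sub_nth fps_mult_left_const_nth theta_nth by (simp add: algebra_simps)
qed

text \<open>This is what Lagrange inversion gives for T = z exp(T). Here it follows by descending
  induction from \<open>m = n\<close>, where \<open>T_1\<close> supplies the leading coefficient of
  T^n.\<close>

lemma T_power_nth:
  assumes "1 \<le> m" "m \<le> n"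
  shows "real n * fps_nth (T ^ m) n * fact (n - m) = real m * real n ^ (n - m)"
  using assms(2,1)
proof (induction m rule: inc_induct)
  case base
  have "fps_nth (T ^ n) n = 1" by (simp add: startsby_zero_power_nth_same[OF T_0] T_1[simplified])
  then show ?case by simp
next
  case (step m)
  obtain d where d: "n = Suc (m + d)" using step(2) by (metis less_iff_Suc_add)
  have IH: "real n * fps_nth (T ^ Suc m) n * fact d = real (Suc m) * real n ^ d"
    using step by (simp add: d)
  have "real (Suc m) * (fps_nth (T ^ m) n * fact (Suc d)) =
      (real (Suc m) * (real n - real m) * fps_nth (T ^ m) n) * fact d"
    by (simp add: d algebra_simps)
  also have "\<dots> = real m * (real n * fps_nth (T ^ Suc m) n * fact d)"
    unfolding T_power_step[symmetric] by (simp only: mult_ac)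
  also have "\<dots> = real (Suc m) * (real m * real n ^ d)" unfolding IH by (simp only: mult_ac)
  finally have "fps_nth (T ^ m) n * fact (Suc d) = real m * real n ^ d"
    by (simp only: mult_cancel_left) simp
  moreover have "n - m = Suc d" by (simp add: d)
  ultimately show ?case by (simp add: mult_ac)
qed

lemma T_power_nonneg: "0 \<le> fps_nth (T ^ m) n"
proof (cases "1 \<le> m \<and> m \<le> n")
  case True
  then have "0 \<le> real n * (fps_nth (T ^ m) n * fact (n - m))"
    using T_power_nth[of m n] by (simp add: mult.assoc)
  moreover have "0 < real n" using True by simp
  ultimately have "0 \<le> fps_nth (T ^ m) n * fact (n - m)" by (simp only: zero_le_mult_iff) linarith
  then show ?thesis by (metis fact_gt_zero zero_le_mult_iff not_less)
next
  case False
  then show ?thesis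
    using startsby_zero_power_prefix[OF T_0, of m] by (cases "m = 0") (auto simp: not_le)
qed

lemma compose_T_majorized: "f \<preceq> h \<Longrightarrow> f oo T \<preceq> h oo T"
  unfolding majorized_def fps_compose_nth
proof (intro allI)
  fix n assume *: "\<forall>n. \<bar>fps_nth f n\<bar> \<le> fps_nth h n"
  have "\<bar>\<Sum>i=0..n. fps_nth f i * fps_nth (T ^ i) n\<bar> \<le> (\<Sum>i=0..n. \<bar>fps_nth f i * fps_nth (T ^ i) n\<bar>)"
    by (rule sum_abs)
  also have "\<dots> \<le> (\<Sum>i=0..n. fps_nth h i * fps_nth (T ^ i) n)"
    unfolding abs_mult abs_of_nonneg[OF T_power_nonneg]
    using * T_power_nonneg by (intro sum_mono mult_right_mono) auto
  finally show "\<bar>\<Sum>i=0..n. fps_nth f i * fps_nth (T ^ i) n\<bar> \<le> (\<Sum>i=0..n. fps_nth h i * fps_nth (T ^ i) n)" .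
qed

text \<open>Because (1 - T) theta T = T, the operator (1 - T) theta acts on \<open>g oo T\<close> as
  \<open>theta\<close> acts on \<open>g\<close>, so the equation pulls back to
  \<open>theta g + g = s\<close>. For uniqueness, a solution \<open>d\<close> of the homogeneous
  equation satisfies \<open>theta d + d = T * theta d\<close>, whose right side starts one degree
  later than \<open>d\<close>.\<close>

lemma solve_theta_equation:
  assumes "(1 - T) * theta f + f = s oo T"
  shows "f = Abs_fps (\<lambda>m. fps_nth s m / (real m + 1)) oo T"
proof -
  define g where "g = Abs_fps (\<lambda>m. fps_nth s m / (real m + 1))"
  define d where "d = f - (g oo T)"
  have g: "theta g + g = s"
  proof (rule fps_ext)
    fix n
    let ?c = "fps_nth s n"
    have "fps_nth (theta g + g) n = real n * (?c / (real n + 1)) + ?c / (real n + 1)"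
      by (simp add: theta_nth g_def)
    also have "\<dots> = (real n + 1) * (?c / (real n + 1))" by (simp only: distrib_right mult_1_left)
    finally show "fps_nth (theta g + g) n = ?c" by simp
  qed
  have "theta (g oo T) = (fps_deriv g oo T) * theta T"
    unfolding theta_def fps_compose_deriv[OF T_0] by (simp only: mult_ac)
  then have "(1 - T) * theta (g oo T) = (fps_deriv g oo T) * ((1 - T) * theta T)"
    by (simp only: mult_ac)
  also have "\<dots> = (fps_deriv g oo T) * T" by (simp only: T_eq)
  also have "\<dots> = theta g oo T"
    by (simp add: theta_def fps_compose_mult_distrib[OF T_0] mult_ac T_0)
  finally have "(1 - T) * theta (g oo T) + (g oo T) = s oo T"
    by (simp add: g[symmetric] fps_compose_add_distrib)
  then have "theta d + d = T * theta d"
    using assms unfolding d_def theta_diff by (simp add: algebra_simps)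
  note ode = this
  have "vanishes n d" for n
  proof (induction n)
    case 0
    show ?case by (simp add: vanishes_def)
  next
    case (Suc n)
    have "vanishes (Suc n) (theta d + d)"
      unfolding ode using T_0 vanishes_theta[OF Suc] by (rule vanishes_mult)
    then have "(real n + 1) * fps_nth d n = 0"
      by (simp add: vanishes_def theta_nth algebra_simps)
    moreover have "real n + 1 \<noteq> 0" by linarith
    ultimately have "fps_nth d n = 0" by simp
    then show ?case using Suc by (auto simp: vanishes_def less_Suc_eq)
  qed
  then have "d = 0" by (intro fps_ext) (auto simp: vanishes_def)
  then show ?thesis by (simp add: d_def g_def)
qed

definition "K = geom oo T"

lemma K_mult: "(1 - T) * K = 1"
proof -
  have "((1 - fps_X) * geom) oo T = 1 oo T" by (simp only: geom_mult)
  then show ?thesis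
    by (simp add: fps_compose_mult_distrib[OF T_0] fps_compose_sub_distrib K_def T_0)
qed

lemma geom_power_compose: "geom ^ k oo T = K ^ k"
  by (simp add: K_def fps_compose_power[OF T_0])

lemma theta_T: "theta T = K - 1"
proof -
  have "theta T = ((1 - T) * K) * theta T" by (simp add: K_mult)
  also have "\<dots> = K * ((1 - T) * theta T)" by (simp only: mult_ac)
  also have "\<dots> = K - (1 - T) * K" unfolding T_eq by (simp add: algebra_simps)
  finally show ?thesis by (simp add: K_mult)
qed

lemma theta_K: "theta K = K ^ 3 - K ^ 2"
proof -
  have "theta ((1 - T) * K) = 0" by (simp add: K_mult theta_1)
  then have "(1 - T) * theta K = (K - 1) * K"
    by (simp add: theta_mult theta_diff theta_1 theta_T algebra_simps)
  then have "((1 - T) * K) * theta K = K * ((K - 1) * K)" by (metis mult.assoc mult.commute)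
  then have "theta K = K * ((K - 1) * K)" by (simp only: K_mult mult_1_left)
  then show ?thesis by (simp add: power2_eq_square power3_eq_cube algebra_simps)
qed

lemma K3_nth: "fps_nth (K ^ 3) n = fps_nth (K ^ 2) n + real n * fps_nth K n"
  using arg_cong[OF theta_K, of "\<lambda>f. fps_nth f n"] by (simp add: theta_nth)

lemma K_nth: "n \<ge> 1 \<Longrightarrow> fps_nth K n * fact n = real n ^ n"
proof -
  assume n: "n \<ge> 1"
  obtain d where d: "n = Suc d" using n by (cases n) auto
  have "fps_nth K n = real n * fps_nth T n"
    using arg_cong[OF theta_T, of "\<lambda>f. fps_nth f n"] n by (simp add: theta_nth)
  moreover have "real n * fps_nth T n * fact d = real n ^ d"
    using T_power_nth[of 1 n] n by (simp add: d)
  ultimately have "fps_nth K n * fact d = real n ^ d" by simp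
  moreover have "fps_nth K n * fact n = real n * (fps_nth K n * fact d)" by (simp add: d)
  ultimately show ?thesis by (simp add: d)
qed

lemma K2_nonneg: "0 \<le> fps_nth (K ^ 2) n"
proof -
  have "geom ^ 2 \<preceq> geom ^ 2" by (simp add: majorized_def geom2_nth)
  then have "K ^ 2 \<preceq> K ^ 2" using compose_T_majorized geom_power_compose by metis
  then show ?thesis unfolding majorized_def by (metis abs_ge_zero order_trans)
qed

text \<open>The square of i + 1 - 2 r being nonnegative gives K^2 \<le> K^3/(2 r) + r K
  coefficientwise, for every r > 0. With K^3 = K^2 + n K at degree n, the choice r = sqrt n gives
  the coefficient n/(2 r) + r = (3/2) r of K; moving K^2/(2 r), at most half of K^2, to the left
  doubles it to 3 r.\<close>

lemma K2_nth_le: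
  assumes "n \<ge> 1"
  shows "fps_nth (K ^ 2) n \<le> 3 * sqrt (real n) * fps_nth K n"
proof -
  define r where "r = sqrt (real n)"
  have r: "r \<ge> 1" "r * r = real n" using assms by (simp_all add: r_def)
  have "geom ^ 2 \<preceq> fps_const (1 / (2 * r)) * geom ^ 3 + fps_const r * geom"
    unfolding majorized_def
  proof
    fix i
    have "0 \<le> (real i + 1 - 2 * r)\<^sup>2" by simp
    then have "4 * r * (real i + 1) \<le> (real i + 1) * (real i + 2) + 4 * r * r"
      by (simp add: power2_eq_square algebra_simps)
    then have "real i + 1 \<le> ((real i + 1) * (real i + 2) + 4 * r * r) / (4 * r)"
      using r by (simp add: field_simps)
    also have "\<dots> = 1 / (2 * r) * ((real i + 1) * (real i + 2) / 2) + r"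
      using r by (simp add: field_simps)
    finally show "\<bar>fps_nth (geom ^ 2) i\<bar> \<le> fps_nth (fps_const (1 / (2 * r)) * geom ^ 3 + fps_const r * geom) i"
      by (simp add: geom2_nth geom3_nth geom_nth)
  qed
  from compose_T_majorized[OF this]
  have "fps_nth (K ^ 2) n \<le> 1 / (2 * r) * fps_nth (K ^ 3) n + r * fps_nth K n"
    by (simp add: majorized_def fps_compose_add_distrib fps_compose_mult_distrib[OF T_0]
        geom_power_compose K_def[symmetric]) (metis abs_le_D1)
  then have "2 * r * fps_nth (K ^ 2) n \<le> 2 * r * (1 / (2 * r) * fps_nth (K ^ 3) n + r * fps_nth K n)"
    using r by (intro mult_left_mono) auto
  also have "\<dots> = fps_nth (K ^ 3) n + 2 * (r * r) * fps_nth K n"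
    using r(1) by (simp add: field_simps)
  finally have "(2 * r - 1) * fps_nth (K ^ 2) n \<le> 3 * real n * fps_nth K n"
    unfolding K3_nth r(2) by (simp add: algebra_simps)
  moreover have "r * fps_nth (K ^ 2) n \<le> (2 * r - 1) * fps_nth (K ^ 2) n"
    using r K2_nonneg by (intro mult_right_mono) auto
  moreover have "3 * real n * fps_nth K n = r * (3 * r * fps_nth K n)"
    unfolding r(2)[symmetric] by (simp only: mult_ac)
  ultimately have "r * fps_nth (K ^ 2) n \<le> r * (3 * r * fps_nth K n)" by linarith
  then show ?thesis using r by (simp add: r_def[symmetric])
qed

lemma solution_bound:
  assumes "(1 - T\<^sup>2) * I = 1"
    and "4 * ((1 - T) * theta f + f) =
      I ^ 4 * T ^ 4 * (4 + T ^ 4) * (1 + T)\<^sup>2 + 2 * (I ^ 3 * T ^ 6) - 4 * (I\<^sup>2 * T ^ 4) * (1 + T)"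
    and n: "n \<ge> 1"
  shows "\<bar>fps_nth f n * fact n - 5 / 48 * real n ^ (n + 1)\<bar> \<le> 27 * sqrt (real n) * real n ^ n"
proof -
  note comp = fps_compose_mult_distrib[OF T_0] fps_compose_add_distrib fps_compose_sub_distrib
    fps_compose_power[OF T_0, symmetric]
  have "(1 - T\<^sup>2) * (geom_even oo T) = 1"
  proof -
    have "((1 - fps_X\<^sup>2) * geom_even) oo T = 1 oo T" by (simp only: geom_even_mult)
    then show ?thesis by (simp add: comp T_0)
  qed
  then have I: "I = geom_even oo T" using assms(1) by (metis mult.assoc mult.commute mult_1)
  have num: "numeral k oo T = numeral k" for k
    by (simp add: fps_numeral_fps_const)
  have "source oo T = fps_const (1 / 4) * (4 * ((1 - T) * theta f + f))"
    unfolding source_def assms(2) I by (simp add: comp num T_0)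
  also have "\<dots> = (1 - T) * theta f + f"
    by (simp add: fps_numeral_fps_const mult.assoc[symmetric])
  finally have "f = source_int oo T"
    unfolding source_int_def by (intro solve_theta_equation) simp
  then have "f - fps_const (5 / 48) * K ^ 3 \<preceq> fps_const 8 * K ^ 2"
    using compose_T_majorized[OF source_int_majorized] by (simp add: comp geom_power_compose K_def T_0)
  then have "\<bar>fps_nth f n - 5 / 48 * fps_nth (K ^ 3) n\<bar> \<le> 8 * fps_nth (K ^ 2) n"
    by (simp add: majorized_def)
  \<comment> \<open>By \<open>K3_nth\<close>, replacing \<open>K ^ 3\<close> by n \<open>K\<close>
    costs 5/48 of \<open>K ^ 2\<close>, which is rounded up to raise 8 to 9;
    \<open>K2_nth_le\<close> then gives 9 * 3 = 27.\<close>
  then have "\<bar>fps_nth f n - 5 / 48 * (real n * fps_nth K n)\<bar> \<le> 9 * fps_nth (K ^ 2) n"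
  proof -
    have "\<bar>a - 5 / 48 * y\<bar> \<le> 9 * x" if "\<bar>a - 5 / 48 * (x + y)\<bar> \<le> 8 * x" "0 \<le> x" for a x y :: real
      using that unfolding abs_le_iff distrib_left by linarith
    then show ?thesis
      using \<open>\<bar>fps_nth f n - 5 / 48 * fps_nth (K ^ 3) n\<bar> \<le> 8 * fps_nth (K ^ 2) n\<close> K2_nonneg
      unfolding K3_nth by blast
  qed
  also have "\<dots> \<le> 27 * sqrt (real n) * fps_nth K n"
    using K2_nth_le[OF n] by simp
  finally have "\<bar>fps_nth f n - 5 / 48 * (real n * fps_nth K n)\<bar> * fact n \<le> 27 * sqrt (real n) * fps_nth K n * fact n"
    by (rule mult_right_mono) simp
  moreover have "\<bar>fps_nth f n - 5 / 48 * (real n * fps_nth K n)\<bar> * fact n =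
      \<bar>fps_nth f n * fact n - 5 / 48 * (real n * (fps_nth K n * fact n))\<bar>"
  proof -
    have "\<bar>x\<bar> * fact n = \<bar>x * fact n\<bar>" for x :: real by (simp add: abs_mult)
    then show ?thesis by (simp only: left_diff_distrib mult.assoc)
  qed
  ultimately show ?thesis unfolding mult.assoc[of _ "fps_nth K n"] K_nth[OF n] by simp
qed

end

section \<open>From the error bound to asymptotic equivalence\<close>

lemma asymp_equiv_of_sqrt_error:
  fixes f :: "nat \<Rightarrow> real"
  assumes "c > 0" and bound: "\<And>n. n \<ge> 1 \<Longrightarrow> \<bar>f n - c * real n ^ (n + 1)\<bar> \<le> C * sqrt (real n) * real n ^ n"
  shows "f \<sim>[at_top] (\<lambda>n. c * real n ^ (n + 1))"
proof (rule asymp_equivI')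
  have le: "\<bar>f n / (c * real n ^ (n + 1)) - 1\<bar> \<le> C / c / sqrt (real n)" if n: "n \<ge> 1" for n
  proof -
    have pos: "c * real n ^ (n + 1) > 0" using n assms(1) by simp
    have "\<bar>f n / (c * real n ^ (n + 1)) - 1\<bar> = \<bar>f n - c * real n ^ (n + 1)\<bar> / (c * real n ^ (n + 1))"
    proof -
      have "\<bar>y / p - 1\<bar> = \<bar>y - p\<bar> / p" if "p > 0" for y p :: real
      proof -
        have "y / p - 1 = (y - p) / p" using that by (simp add: diff_divide_distrib)
        then show ?thesis using that by (simp add: abs_divide)
      qed
      then show ?thesis using pos by blast
    qed
    also have "\<dots> \<le> C * sqrt (real n) * real n ^ n / (c * real n ^ (n + 1))"
      using bound[OF n] pos by (intro divide_right_mono) auto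
    also have "\<dots> = C / c / sqrt (real n)"
    proof -
      have "real n ^ (n + 1) = real n ^ n * (sqrt (real n) * sqrt (real n))" by simp
      then show ?thesis using n assms(1) by (simp add: field_simps)
    qed
    finally show ?thesis .
  qed
  have "(\<lambda>n. C / c / sqrt (real n)) \<longlonglongrightarrow> 0"
    by (rule tendsto_divide_0[OF tendsto_const filterlim_at_top_imp_at_infinity])
      (rule filterlim_compose[OF sqrt_at_top filterlim_real_sequentially])
  then have "(\<lambda>n. f n / (c * real n ^ (n + 1)) - 1) \<longlonglongrightarrow> 0"
  proof (rule tendsto_0_le[where K = 1])
    show "\<forall>\<^sub>F n in sequentially. norm (f n / (c * real n ^ (n + 1)) - 1) \<le> norm (C / c / sqrt (real n)) * 1"
      using eventually_ge_at_top[of 1]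
    proof eventually_elim
      case (elim n)
      then show ?case using order_trans[OF le abs_ge_self] by simp
    qed
  qed
  then show "(\<lambda>n. f n / (c * real n ^ (n + 1))) \<longlonglongrightarrow> 1"
    by (simp add: LIM_zero_iff)
qed

theorem theorem1p4:
  "(\<lambda>n::nat. real (N_bi_total n 2)) \<sim>[at_top] (\<lambda>n. 5 / 48 * real n ^ (n + 1))"
proof (rule asymp_equiv_of_sqrt_error[where C = 27])
  interpret tree_series "diag N_series.A"
    by unfold_locales (fact N_series.diag_A_nth N_series.theta_diag_A')+
  fix n :: nat assume "n \<ge> 1"
  moreover have "(1 - (diag N_series.A)\<^sup>2) * diag N_series.J = 1"
    using N_series.diag_J by (simp add: power2_eq_square)
  ultimately have "\<bar>fps_nth (diag bicyclic_egf) n * fact n - 5 / 48 * real n ^ (n + 1)\<bar> \<le>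
      27 * sqrt (real n) * real n ^ n"
    using N_series.diag_F2 by (intro solution_bound)
  then show "\<bar>real (N_bi_total n 2) - 5 / 48 * real n ^ (n + 1)\<bar> \<le> 27 * sqrt (real n) * real n ^ n"
    by (simp add: diag_bicyclic_egf_nth)
qed simp

end
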